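(* As $n\to\infty$, for every integer $k$ with $1\le k\le n-1$, $$\mathrm{gap}(n,k)=(1+o(1))\,\gamma(n,k),$$ where $\mathrm{gap}(n,k)$ is the spectral gap of a single card in the overlapping-cycles shuffle with parameters $n$ and $k$, and $$\gamma(n,k)=\min_{m\in\mathbb{Z},\,m\ne0}\gamma(n,k,m),\qquad \gamma(n,k,m)=\frac{\pi^2}{2n^2}\left(\frac{m^2k}{n}+4n\left\|\frac{m(n-k)}{2n}\right\|^2\right).$$ Here the $o(1)$ tends to $0$ as $n\to\infty$ uniformly over the full range $1\le k\le n-1$.
   Context: For real $x$, $\|x\|=\mathrm{dist}(x,\mathbb{Z})$ is the distance from $x$ to the nearest integer. Let $n$ and $k$ be integers with $1\le k<n$. The overlapping-cycles shuffle with parameters $n,k$ acts on a deck of $n$ cards: at each step a fair coin is flipped to decide whether to move the card in position $n$ or the card in position $n-k$ to the top of the deck (position $1$). The position of a single card is a Markov chain on $\{1,\dots,n\}$ with the following transitions: from $i\in[1,n-k-1]$ to $i+1$ with probability $1$; from $n-k$ to $1$ or to $n-k+1$, each with probability $1/2$; from $i\in[n-k+1,n-1]$ to $i$ or to $i+1$, each with probability $1/2$; from $n$ to $1$ or to $n$, each with probability $1/2$. $\mathrm{gap}(n,k)$ denotes the spectral gap of this single-card chain, i.e. $1-\max|\lambda|$, where the maximum is over the $n$ eigenvalues of its transition matrix (counted with algebraic multiplicity) after removing one copy of the eigenvalue $1$. *)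

theory Defs
  imports "HOL-Probability.Probability" "Jordan_Normal_Form.Char_Poly"
begin

text \<open>
  Positions are \<open>1, \<dots>, n\<close>. One step of the
  single-card chain, started from position \<open>i\<close>; only \<open>1 \<le> k < n\<close> and \<open>1 \<le> i \<le> n\<close> are meaningful.
\<close>

definition oc_step :: "nat \<Rightarrow> nat \<Rightarrow> nat \<Rightarrow> nat pmf" where
  "oc_step n k i =
     (if i < n - k then return_pmf (i + 1)
      else if i = n - k then pmf_of_set {1, n - k + 1}
      else if i < n then pmf_of_set {i, i + 1}
      else pmf_of_set {1, n})"

text \<open>New position of the card at position \<open>i\<close> when the card at position \<open>p\<close> is moved to the top.\<close>

definition move_to_top :: "nat \<Rightarrow> nat \<Rightarrow> nat" where
  "move_to_top p i = (if i = p then 1 else if i < p then i + 1 else i)"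

lemma pmf_of_set_two_eq_coin:
  assumes "a \<noteq> b"
  shows "pmf_of_set {a, b} = map_pmf (\<lambda>c. if c then a else b) (bernoulli_pmf (1/2))"
proof -
  have "bij_betw (\<lambda>c. if c then a else b) UNIV {a, b}"
    using assms by (auto simp: bij_betw_def inj_on_def UNIV_bool)
  then have "map_pmf (\<lambda>c. if c then a else b) (pmf_of_set UNIV) = pmf_of_set {a, b}"
    by (intro map_pmf_of_set_bij_betw) auto
  then show ?thesis
    by (simp add: bernoulli_pmf_half_conv_pmf_of_set)
qed

lemma oc_step_eq_shuffle:
  assumes "1 \<le> k" "k < n" "1 \<le> i" "i \<le> n"
  shows "oc_step n k i =
           map_pmf (\<lambda>c. move_to_top (if c then n else n - k) i) (bernoulli_pmf (1/2))"
proof -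
  consider "i < n - k" | "i = n - k" | "n - k < i" "i < n" | "i = n"
    using assms by linarith
  then show ?thesis
  proof cases
    case 1
    then have "(\<lambda>c. move_to_top (if c then n else n - k) i) = (\<lambda>_. i + 1)"
      using 1 by (auto simp: move_to_top_def fun_eq_iff)
    then show ?thesis using 1 by (simp add: oc_step_def)
  next
    case 2
    have "pmf_of_set {1, n - k + 1} = pmf_of_set {n - k + 1, 1}" by (simp add: insert_commute)
    also have "\<dots> = map_pmf (\<lambda>c. if c then n - k + 1 else 1) (bernoulli_pmf (1/2))"
      using assms by (intro pmf_of_set_two_eq_coin) auto
    also have "\<dots> = map_pmf (\<lambda>c. move_to_top (if c then n else n - k) i) (bernoulli_pmf (1/2))"
      using 2 assms by (intro map_pmf_cong) (auto simp: move_to_top_def)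
    finally show ?thesis using 2 by (simp add: oc_step_def)
  next
    case 3
    have "pmf_of_set {i, i + 1} = pmf_of_set {i + 1, i}" by (simp add: insert_commute)
    also have "\<dots> = map_pmf (\<lambda>c. if c then i + 1 else i) (bernoulli_pmf (1/2))"
      by (intro pmf_of_set_two_eq_coin) auto
    also have "\<dots> = map_pmf (\<lambda>c. move_to_top (if c then n else n - k) i) (bernoulli_pmf (1/2))"
      using 3 assms by (intro map_pmf_cong) (auto simp: move_to_top_def)
    finally show ?thesis using 3 by (simp add: oc_step_def)
  next
    case 4
    have "pmf_of_set {1, n} = map_pmf (\<lambda>c. if c then 1 else n) (bernoulli_pmf (1/2))"
      using assms by (intro pmf_of_set_two_eq_coin) auto
    also have "\<dots> = map_pmf (\<lambda>c. move_to_top (if c then n else n - k) i) (bernoulli_pmf (1/2))"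
      using 4 assms by (intro map_pmf_cong) (auto simp: move_to_top_def)
    finally show ?thesis using 4 assms by (auto simp: oc_step_def)
  qed
qed

text \<open>Matrix indices start at \<open>0\<close>, hence the shift by one.\<close>

definition oc_matrix :: "nat \<Rightarrow> nat \<Rightarrow> complex Matrix.mat" where
  "oc_matrix n k = Matrix.mat n n (\<lambda>(i, j). complex_of_real (pmf (oc_step n k (i + 1)) (j + 1)))"

text \<open>The roots of the characteristic polynomial are the eigenvalues with algebraic multiplicity.\<close>

definition oc_gap :: "nat \<Rightarrow> nat \<Rightarrow> real" where
  "oc_gap n k = 1 - Max (norm ` set_mset (proots (char_poly (oc_matrix n k)) - {#1#}))"

lemma oc_nontrivial_eigenvalues_nonempty:
  assumes "1 \<le> k" "k < n"
  shows "set_mset (proots (char_poly (oc_matrix n k)) - {#1#}) \<noteq> {}"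
proof -
  have "oc_matrix n k \<in> carrier_mat n n"
    by (simp add: oc_matrix_def)
  then have "size (proots (char_poly (oc_matrix n k))) = n"
    using degree_monic_char_poly[of "oc_matrix n k" n] by (simp add: size_proots_complex)
  then have "size (proots (char_poly (oc_matrix n k)) - {#1#}) > 0"
    using assms diff_size_le_size_Diff[of "proots (char_poly (oc_matrix n k))" "{#1#}"] by simp
  then show ?thesis by (simp only: set_mset_eq_empty_iff nonempty_has_size)
qed

definition dist_int :: "real \<Rightarrow> real" where
  "dist_int x = infdist x \<int>"

definition oc_gamma_m :: "nat \<Rightarrow> nat \<Rightarrow> int \<Rightarrow> real" where
  "oc_gamma_m n k m =
     pi\<^sup>2 / (2 * real n ^ 2) *
       (of_int m ^ 2 * real k / real n
        + 4 * real n * (dist_int (of_int m * (real n - real k) / (2 * real n)))\<^sup>2)"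

definition oc_gamma :: "nat \<Rightarrow> nat \<Rightarrow> real" where
  "oc_gamma n k = (INF m\<in>{m::int. m \<noteq> 0}. oc_gamma_m n k m)"

text \<open>The infimum is a minimum.\<close>

lemma oc_gamma_attained:
  assumes "1 \<le> k" "k < n"
  shows "\<exists>m. m \<noteq> 0 \<and> oc_gamma n k = oc_gamma_m n k m \<and>
           (\<forall>m'. m' \<noteq> 0 \<longrightarrow> oc_gamma_m n k m \<le> oc_gamma_m n k m')"
proof -
  define c where "c = pi\<^sup>2 / (2 * real n ^ 2) * (real k / real n)"
  define B where "B = oc_gamma_m n k 1"
  have c: "c > 0" using assms by (simp add: c_def)
  have lower: "c * of_int m ^ 2 \<le> oc_gamma_m n k m" for m
    unfolding c_def oc_gamma_m_def mult.assoc by (intro mult_left_mono) (auto simp: mult.commute)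
  define S where "S = {m::int. m \<noteq> 0 \<and> oc_gamma_m n k m \<le> B}"
  have "S \<subseteq> {- \<lceil>B / c\<rceil> .. \<lceil>B / c\<rceil>}"
  proof
    fix m assume "m \<in> S"
    then have "c * of_int m ^ 2 \<le> B" using lower[of m] by (auto simp: S_def)
    then have "real_of_int (m ^ 2) \<le> B / c" using c by (simp add: field_simps)
    then have m2: "m ^ 2 \<le> \<lceil>B / c\<rceil>" by linarith
    have "\<bar>m\<bar> \<le> m ^ 2"
      by (metis abs_ge_zero abs_le_square_iff abs_mult_self_eq linorder_not_less mult.commute
          mult_cancel_right2 mult_le_cancel_left1 order_le_less power2_eq_square zless_imp_add1_zle
          add_0)
    then show "m \<in> {- \<lceil>B / c\<rceil> .. \<lceil>B / c\<rceil>}" using m2 by auto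
  qed
  then have fin: "finite S" using finite_subset by blast
  have ne: "1 \<in> S" by (simp add: S_def B_def)
  define m where "m = arg_min_on (oc_gamma_m n k) S"
  have mS: "m \<in> S" unfolding m_def using fin ne by (intro arg_min_if_finite) auto
  have min: "oc_gamma_m n k m \<le> oc_gamma_m n k m'" if "m' \<noteq> 0" for m'
  proof (cases "m' \<in> S")
    case True
    then show ?thesis unfolding m_def using fin by (intro arg_min_least) auto
  next
    case False
    then show ?thesis using that mS by (auto simp: S_def)
  qed
  have "oc_gamma n k = oc_gamma_m n k m"
    unfolding oc_gamma_def using mS min by (intro cInf_eq_minimum) (auto simp: S_def)
  then show ?thesis using mS min by (auto simp: S_def)
qed

end

theory Submission
  imports Defs
begin

text \<open>
  With \<open>a = n - k\<close>, the eigenvalues are the solutions of \<open>(2 * x - 1) ^ k * (2 * x ^ a - 1) = 1\<close>, and \<open>1\<close> is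
  a simple one. For \<open>x = exp z\<close> near the unit circle let \<open>u = a * z - 2 * pi * \<i> * j\<close> be the representative
  of \<open>a * z\<close> near \<open>0\<close>. Taking logarithms, with \<open>Ln (2 * exp z - 1) = 2 * z - z\<^sup>2 + O(z ^ 3)\<close>, gives
  \<open>2 * n * z = 2 * pi * \<i> * m + k * z\<^sup>2 + u\<^sup>2 + O(k * |z| ^ 3 + |u| ^ 3)\<close>. To first order \<open>z\<close> is
  \<open>\<i> * pi * m / n\<close>, and the real part of the second order term turns \<open>- Re z\<close> into \<open>oc_gamma_m n k m\<close>.
  All errors are measured by the single quantity \<open>k * |z|\<^sup>2 + |u|\<^sup>2\<close>, which makes them uniform in \<open>k\<close>.
  It is small at the relevant \<open>m\<close> because Dirichlet approximation yields \<open>n * oc_gamma n k \<longlonglongrightarrow> 0\<close>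
  uniformly in \<open>k\<close>, and small at every eigenvalue \<open>x\<close> with \<open>n * (1 - |x|)\<close> small because
  \<open>|2 * x - 1|\<close> and \<open>|2 * x ^ a - 1|\<close> are increased by a nonzero argument while the product of their
  powers is \<open>1\<close>. Conversely, Brouwer's theorem produces an eigenvalue for each admissible \<open>m\<close>.
\<close>

section \<open>The characteristic polynomial\<close>

text \<open>The vector \<open>f\<close> solves every row of \<open>M f = 0\<close> except the last,
  so only the defect in the last row and the superdiagonal survive. For a characteristic matrix, the
  first rows determine an eigenvector entry by entry and the last row becomes the eigenvalue
  condition.\<close>

lemma det_lower_Hessenberg:
  fixes M :: "'a::comm_ring_1 Matrix.mat" and f :: "nat \<Rightarrow> 'a"
  assumes M: "M \<in> carrier_mat n n" and n: "n > 0"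
    and f0: "f 0 = 1"
    and kernel: "\<And>i. i < n - 1 \<Longrightarrow> (\<Sum>j<n. M $$ (i,j) * f j) = 0"
    and hess: "\<And>i j. i < n \<Longrightarrow> j < n \<Longrightarrow> Suc i < j \<Longrightarrow> M $$ (i,j) = 0"
  shows "Determinant.det M =
    (-1)^(n-1) * (\<Sum>j<n. M $$ (n-1,j) * f j) * (\<Prod>i<n-1. M $$ (i, Suc i))"
proof -
  \<comment> \<open>Replacing the first column by the combination of columns with weights \<open>f\<close> leaves only its last entry.\<close>
  define T where "T = Matrix.mat n n (\<lambda>(i,j). if j = 0 then f i else if i = j then 1 else 0)"
  define N where "N = M * T"
  have T: "T \<in> carrier_mat n n" by (simp add: T_def)
  have N: "N \<in> carrier_mat n n" using M T by (simp add: N_def)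
  have "Determinant.det T = prod_list (diag_mat T)"
    by (rule det_lower_triangular[OF _ T]) (auto simp: T_def)
  also have "\<dots> = (\<Prod>i\<in>{0..<n}. T $$ (i,i))"
    using T by (simp add: prod_list_diag_prod)
  also have "\<dots> = 1"
    by (rule prod.neutral) (auto simp: T_def f0)
  finally have detT: "Determinant.det T = 1" .
  have Nij: "N $$ (i,j) = (if j = 0 then \<Sum>l<n. M $$ (i,l) * f l else M $$ (i,j))"
    if "i < n" "j < n" for i j
  proof -
    have "N $$ (i,j) = (\<Sum>l<n. M $$ (i,l) * T $$ (l,j))"
      using M T that by (simp add: N_def scalar_prod_def atLeast0LessThan)
    also have "\<dots> = (\<Sum>l<n. M $$ (i,l) * (if j = 0 then f l else if l = j then 1 else 0))"
      using that by (intro sum.cong) (auto simp: T_def)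
    also have "\<dots> = (if j = 0 then \<Sum>l<n. M $$ (i,l) * f l else M $$ (i,j))"
    proof (cases "j = 0")
      case False
      have "(\<Sum>l<n. M $$ (i,l) * (if l = j then 1 else 0)) = (\<Sum>l<n. if l = j then M $$ (i,l) else 0)"
        by (intro sum.cong) auto
      then show ?thesis using False that by simp
    qed simp
    finally show ?thesis .
  qed
  define D where "D = mat_delete N (n-1) 0"
  have D: "D \<in> carrier_mat (n-1) (n-1)"
    unfolding D_def using mat_delete_carrier[OF N] .
  have Dij: "D $$ (i,j) = M $$ (i, Suc j)" if "i < n-1" "j < n-1" for i j
    using that N Nij[of i "Suc j"] by (simp add: D_def mat_delete_def)
  have "Determinant.det D = prod_list (diag_mat D)"
    by (rule det_lower_triangular[OF _ D]) (use Dij hess in auto)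
  also have "\<dots> = (\<Prod>i\<in>{0..<n-1}. D $$ (i,i))"
    using D by (simp add: prod_list_diag_prod)
  also have "\<dots> = (\<Prod>i<n-1. M $$ (i, Suc i))"
    using Dij by (intro prod.cong) auto
  finally have detD: "Determinant.det D = (\<Prod>i<n-1. M $$ (i, Suc i))" .
  have "Determinant.det M = Determinant.det N"
    unfolding N_def det_mult[OF M T] detT by simp
  also have "\<dots> = (\<Sum>i<n. N $$ (i,0) * cofactor N i 0)"
    by (rule laplace_expansion_column[OF N n])
  also have "\<dots> = (\<Sum>i<n. if i = n-1 then N $$ (n-1,0) * cofactor N (n-1) 0 else 0)"
    using n kernel by (intro sum.cong) (auto simp: Nij)
  also have "\<dots> = N $$ (n-1,0) * cofactor N (n-1) 0"
    using n by simp
  also have "cofactor N (n-1) 0 = (-1)^(n-1) * Determinant.det D"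
    by (simp add: cofactor_def D_def)
  also have "N $$ (n-1,0) = (\<Sum>j<n. M $$ (n-1,j) * f j)"
    using n by (simp add: Nij)
  also have "(\<Sum>j<n. M $$ (n-1,j) * f j) * ((-1)^(n-1) * Determinant.det D) =
      (-1)^(n-1) * (\<Sum>j<n. M $$ (n-1,j) * f j) * (\<Prod>i<n-1. M $$ (i, Suc i))"
    by (simp only: detD mult_ac)
  finally show ?thesis .
qed

lemma oc_matrix_carrier: "oc_matrix n k \<in> carrier_mat n n"
  by (simp add: oc_matrix_def)

lemma oc_matrix_index:
  assumes k: "1 \<le> k" "k < n" and ij: "i < n" "j < n"
  shows "oc_matrix n k $$ (i,j) =
    (if Suc i < n - k then of_bool (j = Suc i)
     else if Suc i = n - k then of_bool (j = 0 \<or> j = n - k) / 2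
     else if Suc i < n then of_bool (j = i \<or> j = Suc i) / 2
     else of_bool (j = 0 \<or> j = i) / 2)"
proof -
  have "card {1, Suc (n - k)} = 2" "card {1, n} = 2" "card {Suc i, Suc (Suc i)} = 2"
    using k by auto
  then show ?thesis
    using k ij by (auto simp: oc_matrix_def oc_step_def pmf_of_set indicator_def)
qed

lemma poly_char_poly_eq_det:
  fixes A :: "'a::field Matrix.mat"
  assumes A: "A \<in> carrier_mat n n"
  shows "poly (char_poly A) x =
    Determinant.det (Matrix.mat n n (\<lambda>(i,j). (if i = j then x else 0) - A $$ (i,j)))"
proof -
  have "map_mat (\<lambda>p. poly p x) (char_poly_matrix A) =
      Matrix.mat n n (\<lambda>(i,j). (if i = j then x else 0) - A $$ (i,j))"
    by (rule eq_matI) (use A in \<open>auto simp: char_poly_matrix_def\<close>)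
  moreover have "poly (char_poly A) x = Determinant.det (map_mat (\<lambda>p. poly p x) (char_poly_matrix A))"
    by (simp only: char_poly_def comm_ring_hom.hom_det[OF poly_hom.comm_ring_hom_axioms])
  ultimately show ?thesis by simp
qed

text \<open>The factor \<open>2 ^ Suc k\<close> clears the \<open>k\<close> superdiagonal entries of
  modulus 1/2 and the 1/2 in the last row.\<close>

lemma poly_char_poly_oc_matrix:
  assumes k: "1 \<le> k" "k < n"
  shows "2 ^ Suc k * poly (char_poly (oc_matrix n k)) x =
    (2 * x - 1) ^ k * (2 * x ^ (n - k) - 1) - 1"
proof -
  define a where "a = n - k"
  have a: "a \<ge> 1" "a < n" "n = a + k" using k by (auto simp: a_def)
  define A where "A = oc_matrix n k"
  define M where "M = Matrix.mat n n (\<lambda>(i,j). (if i = j then x else 0) - A $$ (i,j))"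
  \<comment> \<open>Candidate eigenvector with \<open>f 0 = 1\<close>, read off from the rows. The
    deterministic rows multiply by \<open>x\<close>; the row of position \<open>a\<close> reads
    \<open>x ^ a = (1 + f a) / 2\<close>; each later row multiplies by
    \<open>2 * x - 1\<close>.\<close>
  define f where "f j = (if j < a then x ^ j else (2 * x ^ a - 1) * (2 * x - 1) ^ (j - a))" for j
  have Mij: "M $$ (i,j) = (if i = j then x else 0) - A $$ (i,j)" if "i < n" "j < n" for i j
    using that by (simp add: M_def)
  note Aij = oc_matrix_index[OF k, folded A_def a_def]
  have row: "(\<Sum>j<n. M $$ (i,j) * f j) = x * f i - (\<Sum>j<n. A $$ (i,j) * f j)" if "i < n" for i
  proof -
    have "(\<Sum>j<n. M $$ (i,j) * f j) = (\<Sum>j<n. (if i = j then x * f j else 0) - A $$ (i,j) * f j)"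
      using that by (intro sum.cong) (auto simp: Mij algebra_simps)
    then show ?thesis using that by (simp add: sum_subtractf)
  qed
  have two: "(\<Sum>j<n. of_bool (j = p \<or> j = q) / 2 * f j) = (f p + f q) / 2"
    if "p < n" "q < n" "p \<noteq> q" for p q
  proof -
    have "(\<Sum>j<n. of_bool (j = p \<or> j = q) / 2 * f j)
        = (\<Sum>j<n. (if j = p then f j / 2 else 0) + (if j = q then f j / 2 else 0))"
      using that by (intro sum.cong) auto
    then show ?thesis using that by (simp add: sum.distrib add_divide_distrib)
  qed
  have Arow: "(\<Sum>j<n. A $$ (i,j) * f j) =
    (if Suc i < a then f (Suc i) else if Suc i = a then (f 0 + f a) / 2
     else if Suc i < n then (f i + f (Suc i)) / 2 else (f 0 + f i) / 2)" if i: "i < n" for i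
  proof -
    consider "Suc i < a" | "Suc i = a" | "\<not> Suc i < a" "Suc i \<noteq> a" "Suc i < n" | "Suc i = n"
      using i by linarith
    then show ?thesis
    proof cases
      case 1
      then have "(\<Sum>j<n. A $$ (i,j) * f j) = (\<Sum>j<n. if j = Suc i then f j else 0)"
        using i by (intro sum.cong) (auto simp: Aij)
      then show ?thesis using 1 a by simp
    next
      case 2
      then have "(\<Sum>j<n. A $$ (i,j) * f j) = (\<Sum>j<n. of_bool (j = 0 \<or> j = a) / 2 * f j)"
        using i by (intro sum.cong) (auto simp: Aij)
      then show ?thesis using 2 a two[of 0 a] by simp
    next
      case 3
      then have "(\<Sum>j<n. A $$ (i,j) * f j) = (\<Sum>j<n. of_bool (j = i \<or> j = Suc i) / 2 * f j)"
        using i by (intro sum.cong) (auto simp: Aij)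
      then show ?thesis using 3 a two[of i "Suc i"] by simp
    next
      case 4
      then have "(\<Sum>j<n. A $$ (i,j) * f j) = (\<Sum>j<n. of_bool (j = 0 \<or> j = i) / 2 * f j)"
        using i a by (intro sum.cong) (auto simp: Aij)
      moreover have "i \<noteq> 0" using 4 a by auto
      ultimately show ?thesis using 4 a two[of 0 i] by simp
    qed
  qed
  have f0: "f 0 = 1" using a by (simp add: f_def)
  have kernel: "(\<Sum>j<n. M $$ (i,j) * f j) = 0" if i: "i < n - 1" for i
  proof -
    have i': "i < n" using i by simp
    consider "Suc i < a" | "Suc i = a" | "Suc i > a" by linarith
    then show ?thesis
    proof cases
      case 1
      then show ?thesis using i' by (simp add: row Arow) (simp add: f_def)
    next
      case 2
      have "x * x ^ i = x ^ a" by (simp add: 2[symmetric])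
      then show ?thesis using i' 2 f0 by (simp add: row Arow) (simp add: f_def field_simps)
    next
      case 3
      then have "f (Suc i) = (2 * x - 1) * f i" by (simp add: f_def Suc_diff_le)
      moreover have "(\<Sum>j<n. A $$ (i,j) * f j) = (f i + f (Suc i)) / 2"
        using i 3 by (subst Arow) auto
      ultimately have "(\<Sum>j<n. A $$ (i,j) * f j) = x * f i" by (simp add: field_simps)
      then show ?thesis using row[OF i'] by simp
    qed
  qed
  have hess: "M $$ (i,j) = 0" if "i < n" "j < n" "Suc i < j" for i j
    using that a by (auto simp: Mij Aij)
  have fn: "f (n - 1) = (2 * x ^ a - 1) * (2 * x - 1) ^ (k - 1)"
    using a k by (simp add: f_def)
  have pw: "(2 * x - 1) * (2 * x - 1) ^ (k - 1) = (2 * x - 1) ^ k"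
    using k by (cases k) auto
  have last: "(\<Sum>j<n. M $$ (n-1,j) * f j) = ((2 * x - 1) ^ k * (2 * x ^ a - 1) - 1) / 2"
  proof -
    have "(\<Sum>j<n. M $$ (n-1,j) * f j) = ((2 * x - 1) * f (n - 1) - 1) / 2"
    proof -
      have n1: "n - 1 < n" "\<not> Suc (n - 1) < a" "Suc (n - 1) \<noteq> a" "\<not> Suc (n - 1) < n"
        using a k by auto
      have "(\<Sum>j<n. A $$ (n-1,j) * f j) = (1 + f (n - 1)) / 2"
        using n1 f0 by (subst Arow) auto
      moreover have "x * F - (1 + F) / 2 = ((2 * x - 1) * F - 1) / 2" for F :: complex
        by (simp add: field_simps)
      ultimately show ?thesis by (simp only: row[OF n1(1)])
    qed
    also have "(2 * x - 1) * f (n - 1) = (2 * x - 1) ^ k * (2 * x ^ a - 1)"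
      unfolding fn pw[symmetric] by (simp add: algebra_simps)
    finally show ?thesis .
  qed
  have "(\<Prod>i<n-1. M $$ (i, Suc i)) = (\<Prod>i<n-1. - (if i < a - 1 then 1 else 1/2))"
    using a by (intro prod.cong) (auto simp: Mij Aij)
  also have "\<dots> = (-1) ^ (n-1) * (\<Prod>i<n-1. (if i < a - 1 then 1 else 1/2))"
    by (simp add: prod_uminus)
  also have "(\<Prod>i<n-1. (if i < a - 1 then 1 else 1/2)) = (\<Prod>i\<in>{a-1..<n-1}. (1/2 :: complex))"
    by (rule prod.mono_neutral_cong_right) auto
  also have "\<dots> = (1/2) ^ k" using a by simp
  finally have pr: "(\<Prod>i<n-1. M $$ (i, Suc i)) = (-1) ^ (n-1) * (1/2) ^ k" .
  have "poly (char_poly A) x = Determinant.det M"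
    unfolding M_def by (rule poly_char_poly_eq_det) (simp add: A_def oc_matrix_carrier)
  also have "\<dots> = (-1) ^ (n-1) * (\<Sum>j<n. M $$ (n-1,j) * f j) * (\<Prod>i<n-1. M $$ (i, Suc i))"
    by (rule det_lower_Hessenberg[OF _ _ f0 kernel hess]) (use a in \<open>auto simp: M_def\<close>)
  also have "\<dots> = ((-1) ^ (n-1) * (-1) ^ (n-1)) * (((2 * x - 1) ^ k * (2 * x ^ a - 1) - 1) / 2 * (1/2) ^ k)"
    unfolding last pr by (simp only: mult_ac)
  also have "(-1) ^ (n-1) * (-1) ^ (n-1) = (1::complex)"
    by (simp flip: power_mult_distrib)
  finally have "poly (char_poly A) x = 1 * (((2 * x - 1) ^ k * (2 * x ^ a - 1) - 1) / 2 * (1/2) ^ k)" .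
  moreover have "2 ^ Suc k * (1 * (Y / 2 * (1/2) ^ k)) = Y" for Y :: complex
    by (simp add: power_one_over)
  ultimately show ?thesis
    unfolding A_def[symmetric] a_def[symmetric] by (simp only:)
qed

text \<open>The polynomial has derivative \<open>2 * k + 2 * (n - k) = 2 * n\<close> at 1, so 1 is a
  simple root and deleting one copy from the multiset deletes it altogether.\<close>

lemma oc_nontrivial_eigenvalues:
  assumes k: "1 \<le> k" "k < n"
  shows "set_mset (proots (char_poly (oc_matrix n k)) - {#1#}) =
    {x. x \<noteq> 1 \<and> (2 * x - 1) ^ k * (2 * x ^ (n - k) - 1) = 1}"
proof -
  define p where "p = char_poly (oc_matrix n k)"
  define q where "q = [:-1, 2:] ^ k * (2 * [:0, 1:] ^ (n - k) - 1) - (1 :: complex poly)"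
  have pq: "Polynomial.smult (2 ^ Suc k) p = q"
    using poly_char_poly_oc_matrix[OF k]
    by (intro poly_eq_poly_eq_iff[THEN iffD1] ext) (simp add: q_def p_def algebra_simps)
  have p0: "p \<noteq> 0"
    using degree_monic_char_poly[OF oc_matrix_carrier[of n k]] k by (auto simp: p_def)
  have root: "poly p x = 0 \<longleftrightarrow> (2 * x - 1) ^ k * (2 * x ^ (n - k) - 1) = 1" for x
    using poly_char_poly_oc_matrix[OF k, of x] unfolding p_def[symmetric] by auto
  have "poly (pderiv q) 1 = 2 * of_nat k + 2 * of_nat (n - k)"
    by (simp add: q_def pderiv_diff pderiv_mult pderiv_power pderiv_pCons)
  also have "\<dots> = of_nat (2 * n)" using k by (simp add: of_nat_diff)
  also have "\<dots> \<noteq> 0" using k by (simp del: of_nat_mult)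
  finally have dq: "poly (pderiv q) 1 \<noteq> 0" .
  have "order 1 p = order 1 q"
    using pq by (metis order_smult power_not_zero zero_neq_numeral)
  moreover have "\<not> order 1 q \<ge> 2"
  proof
    assume "order 1 q \<ge> 2"
    then have "[:- 1, 1:] ^ 2 dvd q" by (metis order_1 power_le_dvd)
    then obtain s where s: "q = [:- 1, 1:] ^ 2 * s" by (elim dvdE)
    define l where "l = [:- 1, 1 :: complex:]"
    have "poly (pderiv (l * (l * s))) 1 = 0"
      by (simp only: pderiv_mult poly_add poly_mult) (simp add: l_def)
    then have "poly (pderiv q) 1 = 0" by (simp only: s l_def power2_eq_square mult.assoc)
    then show False using dq by simp
  qed
  ultimately have ord1: "order 1 p \<le> 1" by linarith
  have "x \<in># proots p - {#1#} \<longleftrightarrow> x \<noteq> 1 \<and> poly p x = 0" for x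
  proof -
    have "x \<in># proots p - {#1#} \<longleftrightarrow> (if x = 1 then 1 else 0) < order x p"
      using p0 by (simp add: in_diff_count)
    then show ?thesis using ord1 p0 order_gt_0_iff[OF p0, of x] by (cases "x = 1") auto
  qed
  then show ?thesis using root by (auto simp: p_def)
qed

section \<open>The logarithmic eigenvalue equation\<close>

text \<open>Logarithm of the factor \<open>2 * x - 1\<close> at \<open>x = exp z\<close>. The same
  function at \<open>wrapped a j z\<close> serves for the factor
  \<open>2 * x ^ a - 1\<close>.\<close>

definition step_log :: "complex \<Rightarrow> complex" where
  "step_log z = Ln (2 * exp z - 1)"

lemma cmod_exp_minus_1_le:
  assumes "cmod z \<le> 1/4"
  shows "cmod (exp z - 1) \<le> 3/8"
proof -
  have "cmod (exp z - 1) \<le> exp \<bar>Re z\<bar> * cmod z"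
    using Taylor_exp[of z 0] by simp
  also have "\<dots> \<le> (1 + 2 * (1/4)) * (1/4)"
  proof (rule mult_mono)
    have "\<bar>Re z\<bar> \<le> 1/4" using abs_Re_le_cmod[of z] assms by linarith
    then have "exp \<bar>Re z\<bar> \<le> 1 + 2 * \<bar>Re z\<bar>"
      using exp_bound_lemma[of "\<bar>Re z\<bar>"] by simp
    then show "exp \<bar>Re z\<bar> \<le> 1 + 2 * (1/4)" using \<open>\<bar>Re z\<bar> \<le> 1/4\<close> by linarith
  qed (use assms in auto)
  finally show ?thesis by simp
qed

text \<open>Here \<open>1/4 = 1 - 2 * (3/8)\<close>. The value stays in the right half-plane, hence
  away from the branch cut of \<open>Ln\<close> and bounded away from 0.\<close>

lemma Re_two_exp_minus_1:
  assumes "cmod z \<le> 1/4"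
  shows "Re (2 * exp z - 1) \<ge> 1/4"
proof -
  have "\<bar>Re (exp z - 1)\<bar> \<le> 3/8"
    using abs_Re_le_cmod[of "exp z - 1"] cmod_exp_minus_1_le[OF assms] by linarith
  then have "- (3/8) \<le> Re (exp z - 1)" unfolding abs_le_iff by linarith
  then show ?thesis by simp
qed

lemma two_exp_minus_1_nonzero:
  assumes "cmod z \<le> 1/4"
  shows "2 * exp z - 1 \<noteq> 0"
  using Re_two_exp_minus_1[OF assms] by (metis complex_Re_numeral not_numeral_le_zero divide_le_0_1_iff zero_complex.sel(1))

lemma two_exp_minus_1_not_nonpos:
  assumes "cmod z \<le> 1/4"
  shows "2 * exp z - 1 \<notin> \<real>\<^sub>\<le>\<^sub>0"
  using Re_two_exp_minus_1[OF assms] by (auto simp: complex_nonpos_Reals_iff)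

lemma exp_step_log:
  assumes "cmod z \<le> 1/4"
  shows "exp (step_log z) = 2 * exp z - 1"
  using two_exp_minus_1_nonzero[OF assms] by (simp add: step_log_def)

lemma continuous_on_step_log: "continuous_on (cball 0 (1/4)) step_log"
  unfolding step_log_def
  by (intro continuous_intros) (use two_exp_minus_1_not_nonpos in auto)

text \<open>The first bound is Taylor's formula of order two at 0. The second absorbs the square, as
  \<open>600 / 4 + 1\<close> is below 600.\<close>

lemma step_log_expansion:
  assumes z: "cmod z \<le> 1/4"
  shows "cmod (step_log z - 2 * z + z\<^sup>2) \<le> 600 * cmod z ^ 3"
    and "cmod (step_log z - 2 * z) \<le> 600 * (cmod z)\<^sup>2"
proof -
  \<comment> \<open>The derivatives of \<open>step_log\<close> of orders 0 to 3, simplified with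
    \<open>w - 2 * E = -1\<close>. At 0 the first three are 0, 2 and -2.\<close>
  define f :: "nat \<Rightarrow> complex \<Rightarrow> complex" where
    "f i x = (let E = exp x; w = 2 * exp x - 1 in
       if i = 0 then step_log x else if i = 1 then 2 * E / w
       else if i = 2 then - (2 * E / w\<^sup>2) else 8 * E\<^sup>2 / w ^ 3 - 2 * E / w\<^sup>2)" for i x
  have "cmod (f 0 z - (\<Sum>i\<le>2. f i 0 * (z - 0) ^ i / fact i)) \<le> 1200 * cmod (z - 0) ^ Suc 2 / fact 2"
  proof (rule complex_Taylor[where S = "cball 0 (1/4)"])
    fix i :: nat and x :: complex
    assume "x \<in> cball 0 (1/4)" "i \<le> 2"
    then have x: "cmod x \<le> 1/4" by simp
    note nz = two_exp_minus_1_nonzero[OF x] two_exp_minus_1_not_nonpos[OF x]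
    consider "i = 0" | "i = 1" | "i = 2" using \<open>i \<le> 2\<close> by linarith
    then have "(f i has_field_derivative f (Suc i) x) (at x)"
    proof cases
      case 1
      then show ?thesis using nz
        unfolding f_def step_log_def Let_def
        by (auto intro!: derivative_eq_intros simp: field_simps)
    next
      case 2
      then show ?thesis using nz
        unfolding f_def Let_def
        by (auto intro!: derivative_eq_intros simp: field_simps power2_eq_square)
    next
      case 3
      then show ?thesis using nz
        unfolding f_def Let_def
        by (auto intro!: derivative_eq_intros simp: divide_simps) (simp add: algebra_simps eval_nat_numeral)
    qed
    then show "(f i has_field_derivative f (Suc i) x) (at x within cball 0 (1/4))"
      by (rule has_field_derivative_at_within)
  next
    fix x :: complex
    assume "x \<in> cball 0 (1/4)"
    then have x: "cmod x \<le> 1/4" by simp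
    \<comment> \<open>The bounds 3/2 for \<open>E\<close> and 1/4 from below for \<open>w\<close>
      give \<open>1152 + 48 = 1200\<close> for the third derivative. The remainder divides this by
      \<open>fact 2\<close>, whence 600.\<close>
    define E w where "E = exp x" and "w = 2 * exp x - 1"
    have w: "cmod w \<ge> 1/4"
      using Re_two_exp_minus_1[OF x] complex_Re_le_cmod[of w] by (simp add: w_def)
    have E: "cmod E \<le> 3/2"
      using cmod_exp_minus_1_le[OF x] norm_triangle_ineq[of "exp x - 1" 1] by (simp add: E_def)
    have w2: "inverse (cmod w) ^ i \<le> 4 ^ i" for i
      using le_imp_inverse_le[OF w] by (intro power_mono) auto
    have "cmod (8 * E\<^sup>2 / w ^ 3) = 8 * cmod E ^ 2 * inverse (cmod w) ^ 3"
      by (simp add: norm_mult norm_divide norm_power norm_inverse divide_inverse power_inverse)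
    also have "\<dots> \<le> 8 * (3/2) ^ 2 * 64"
      using E w2[of 3] by (intro mult_mono power_mono) auto
    finally have 1: "cmod (8 * E\<^sup>2 / w ^ 3) \<le> 1152" by (simp add: power2_eq_square)
    have "cmod (2 * E / w\<^sup>2) = 2 * cmod E * inverse (cmod w) ^ 2"
      by (simp add: norm_mult norm_divide norm_power norm_inverse divide_inverse power_inverse)
    also have "\<dots> \<le> 2 * (3/2) * 16"
      using E w2[of 2] by (intro mult_mono power_mono) auto
    finally have 2: "cmod (2 * E / w\<^sup>2) \<le> 48" by simp
    have "f (Suc 2) x = 8 * E\<^sup>2 / w ^ 3 - 2 * E / w\<^sup>2"
      by (simp add: f_def E_def w_def Let_def)
    then show "cmod (f (Suc 2) x) \<le> 1200"
      using norm_triangle_ineq4[of "8 * E\<^sup>2 / w ^ 3" "2 * E / w\<^sup>2"] 1 2 by simp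
  qed (use z in auto)
  moreover have "(\<Sum>i\<le>2. f i 0 * (z - 0) ^ i / fact i) = 2 * z - z\<^sup>2"
    by (simp add: f_def step_log_def eval_nat_numeral)
  moreover have "f 0 z = step_log z" by (simp add: f_def)
  ultimately have "cmod (step_log z - (2 * z - z\<^sup>2)) \<le> 1200 * cmod (z - 0) ^ Suc 2 / fact 2"
    by (simp only:)
  then show 3: "cmod (step_log z - 2 * z + z\<^sup>2) \<le> 600 * cmod z ^ 3"
    by (simp add: eval_nat_numeral algebra_simps)
  have "cmod (step_log z - 2 * z) \<le> cmod (step_log z - 2 * z + z\<^sup>2) + cmod (z\<^sup>2)"
    using norm_triangle_ineq4[of "step_log z - 2 * z + z\<^sup>2" "z\<^sup>2"] by simp
  also have "\<dots> \<le> 600 * (cmod z ^ 2 * cmod z) + cmod z ^ 2"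
    using 3 by (simp add: norm_mult eval_nat_numeral mult.assoc)
  also have "\<dots> \<le> 600 * (cmod z ^ 2 * (1/4)) + cmod z ^ 2"
    using z by (intro add_mono mult_left_mono) auto
  also have "\<dots> \<le> 600 * cmod z ^ 2" by simp
  finally show "cmod (step_log z - 2 * z) \<le> 600 * (cmod z)\<^sup>2" .
qed

section \<open>Resonances: solutions of the logarithmic equation\<close>

definition wrapped :: "real \<Rightarrow> int \<Rightarrow> complex \<Rightarrow> complex" where
  "wrapped a j z = of_real a * z - 2 * of_real pi * \<i> * of_int j"

definition energy :: "real \<Rightarrow> real \<Rightarrow> int \<Rightarrow> complex \<Rightarrow> real" where
  "energy k a j z = k * (cmod z)\<^sup>2 + (cmod (wrapped a j z))\<^sup>2"

text \<open>The eigenvalue equation after taking logarithms, with the branch recorded by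
  \<open>m\<close>. The shift by \<open>2 * j\<close> cancels the one inside
  \<open>2 * wrapped a j z\<close>, so that the linear part is
  \<open>2 * (k + a) * z = 2 * pi * \<i> * m\<close>.\<close>

definition resonant :: "real \<Rightarrow> real \<Rightarrow> int \<Rightarrow> int \<Rightarrow> complex \<Rightarrow> bool" where
  "resonant k a j m z \<longleftrightarrow>
     of_real k * step_log z + step_log (wrapped a j z) = 2 * of_real pi * \<i> * (of_int m - 2 * of_int j)"

text \<open>The solution of that linear part, with \<open>n = k + a\<close>.\<close>

definition base_freq :: "real \<Rightarrow> int \<Rightarrow> complex" where
  "base_freq n m = \<i> * of_real (pi * of_int m / n)"

lemma energy_bounds:
  assumes "k \<ge> 1"
  shows "(cmod z)\<^sup>2 \<le> energy k a j z" "k * (cmod z)\<^sup>2 \<le> energy k a j z"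
    "(cmod (wrapped a j z))\<^sup>2 \<le> energy k a j z" "0 \<le> energy k a j z"
proof -
  have "(cmod z)\<^sup>2 * 1 \<le> (cmod z)\<^sup>2 * k" using assms by (intro mult_left_mono) auto
  then show "(cmod z)\<^sup>2 \<le> energy k a j z" by (simp add: energy_def mult.commute add_increasing2)
qed (use assms in \<open>auto simp: energy_def\<close>)

lemma cmod_le_sqrt_energy:
  assumes "k \<ge> 1"
  shows "cmod z \<le> sqrt (energy k a j z)" "cmod (wrapped a j z) \<le> sqrt (energy k a j z)"
  using energy_bounds[OF assms] by (auto intro: real_le_rsqrt)

text \<open>The equation puts \<open>z\<close> within O(energy / n) of
  \<open>v = base_freq (k + a) m\<close>. Cutting the Taylor series and replacing \<open>z\<close>
  by \<open>v\<close> in the quadratic terms both cost a multiple of \<open>S ^ 3\<close>, where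
  \<open>S\<close> is the root of the energy. As \<open>v\<close> and \<open>wrapped a j v\<close>
  are purely imaginary, the quadratic terms at \<open>v\<close> are exactly minus the energy
  there.\<close>

lemma resonant_bounds:
  assumes k: "k \<ge> 1" and a: "a \<ge> 1" and res: "resonant k a j m z"
    and W: "energy k a j z \<le> 1/16"
  shows "\<bar>2 * (k + a) * Re z + energy k a j (base_freq (k + a) m)\<bar>
      \<le> 100000 * sqrt (energy k a j z) * energy k a j z"
    and "\<bar>energy k a j z - energy k a j (base_freq (k + a) m)\<bar>
      \<le> 100000 * sqrt (energy k a j z) * energy k a j z"
proof -
  define n where "n = k + a"
  define S where "S = sqrt (energy k a j z)"
  define u where "u = wrapped a j z"
  define v where "v = base_freq n m"
  define w where "w = wrapped a j v"
  define \<delta> where "\<delta> = z - v"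
  \<comment> \<open>\<open>E\<close> collects the Taylor remainders beyond second order;
    \<open>D\<close> is the change of the quadratic terms between \<open>z\<close> and
    \<open>v\<close>.\<close>
  define E where "E = of_real k * (step_log z - 2 * z + z\<^sup>2) + (step_log u - 2 * u + u\<^sup>2)"
  define D where "D = of_real k * (z\<^sup>2 - v\<^sup>2) + (u\<^sup>2 - w\<^sup>2)"
  have n: "n > 0" using k a by (simp add: n_def)
  have S2: "S\<^sup>2 = energy k a j z" using energy_bounds[OF k] by (simp add: S_def)
  have S0: "0 \<le> S" using energy_bounds[OF k] by (simp add: S_def)
  have S4: "S \<le> 1/4"
    unfolding S_def by (rule real_le_lsqrt) (use W in \<open>auto simp: power2_eq_square\<close>)
  have zS: "cmod z \<le> S" and uS: "cmod u \<le> S"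
    unfolding S_def u_def by (rule cmod_le_sqrt_energy[OF k])+
  have z4: "cmod z \<le> 1/4" and u4: "cmod u \<le> 1/4" using zS uS S4 by auto
  have sum2: "k * (cmod z)\<^sup>2 + (cmod u)\<^sup>2 = S\<^sup>2" unfolding S2 by (simp add: energy_def u_def)
  have E: "cmod E \<le> 600 * S ^ 3"
  proof -
    have "cmod E \<le> cmod (of_real k * (step_log z - 2 * z + z\<^sup>2)) + cmod (step_log u - 2 * u + u\<^sup>2)"
      unfolding E_def by (rule norm_triangle_ineq)
    also have "\<dots> \<le> k * (600 * cmod z ^ 3) + 600 * cmod u ^ 3"
      using step_log_expansion(1)[OF z4] step_log_expansion(1)[OF u4] k
      by (intro add_mono) (auto simp: norm_mult)
    also have "\<dots> = 600 * (k * (cmod z)\<^sup>2 * cmod z + (cmod u)\<^sup>2 * cmod u)"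
      by (simp add: eval_nat_numeral algebra_simps)
    also have "\<dots> \<le> 600 * (k * (cmod z)\<^sup>2 * S + (cmod u)\<^sup>2 * S)"
      using zS uS k by (intro mult_left_mono add_mono) auto
    also have "\<dots> = 600 * (k * (cmod z)\<^sup>2 + (cmod u)\<^sup>2) * S"
      by (simp add: algebra_simps)
    also have "\<dots> = 600 * S ^ 3" unfolding sum2 by (simp add: eval_nat_numeral)
    finally show ?thesis .
  qed
  have twon: "2 * of_real n * z = 2 * of_real n * v + (of_real k * z\<^sup>2 + u\<^sup>2) - E"
  proof -
    have "of_real n * v = of_real pi * \<i> * of_int m"
      using n by (simp add: v_def base_freq_def)
    moreover have "of_real n * z = of_real k * z + u + 2 * (of_real pi * \<i>) * of_int j"
      by (simp add: n_def u_def wrapped_def algebra_simps)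
    moreover have "of_real k * step_log z + step_log u = 2 * (of_real pi * \<i>) * (of_int m - 2 * of_int j)"
      using res by (simp add: resonant_def u_def mult.assoc)
    \<comment> \<open>Pure algebra, stated for opaque letters and instantiated afterwards:
      \<open>P\<close> stands for \<open>pi * \<i>\<close>, \<open>l\<close> and \<open>l'\<close>
      for the two logarithms.\<close>
    moreover have "2 * N * z = 2 * N * v + (K * z\<^sup>2 + u\<^sup>2) - (K * (l - 2 * z + z\<^sup>2) + (l' - 2 * u + u\<^sup>2))"
      if "N * v = P * M" "N * z = K * z + u + 2 * P * J" "K * l + l' = 2 * P * (M - 2 * J)"
      for N K l l' P M J :: complex
    proof -
      have "2 * N * z = 2 * N * v + 2 * (N * z) - 2 * (N * v)" by simp
      also have "\<dots> = 2 * N * v + 2 * (K * z + u) - 2 * P * (M - 2 * J)"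
        unfolding that(1,2) by (simp add: algebra_simps)
      finally show ?thesis unfolding that(3)[symmetric] by (simp add: algebra_simps)
    qed
    ultimately show ?thesis
      unfolding E_def by blast
  qed
  \<comment> \<open>The linear expansion suffices here: \<open>2 * n * \<delta>\<close> is minus the
    sum of the first order remainders.\<close>
  have \<delta>: "n * cmod \<delta> \<le> 300 * S\<^sup>2"
  proof -
    have "2 * of_real n * \<delta> = - (of_real k * (step_log z - 2 * z) + (step_log u - 2 * u))"
      using twon by (simp add: \<delta>_def E_def algebra_simps)
    moreover have "cmod (2 * of_real n * \<delta>) = 2 * n * cmod \<delta>"
      using n by (simp add: norm_mult)
    ultimately have "2 * n * cmod \<delta> = cmod (of_real k * (step_log z - 2 * z) + (step_log u - 2 * u))"
      by (simp only: norm_minus_cancel)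
    also have "\<dots> \<le> cmod (of_real k * (step_log z - 2 * z)) + cmod (step_log u - 2 * u)"
      by (rule norm_triangle_ineq)
    also have "\<dots> \<le> k * (600 * (cmod z)\<^sup>2) + 600 * (cmod u)\<^sup>2"
      using step_log_expansion(2)[OF z4] step_log_expansion(2)[OF u4] k
      by (intro add_mono) (auto simp: norm_mult)
    also have "\<dots> = 600 * S\<^sup>2" unfolding sum2[symmetric] by (simp add: algebra_simps)
    finally show ?thesis by simp
  qed
  have uw: "u - w = of_real a * \<delta>"
    by (simp add: u_def w_def wrapped_def \<delta>_def algebra_simps)
  have zv: "k * cmod (z\<^sup>2 - v\<^sup>2) \<le> k * (cmod \<delta> * (2 * S + cmod \<delta>))"
  proof -
    have "z\<^sup>2 - v\<^sup>2 = \<delta> * (2 * z - \<delta>)" by (simp add: \<delta>_def power2_eq_square algebra_simps)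
    then have "cmod (z\<^sup>2 - v\<^sup>2) = cmod \<delta> * cmod (2 * z - \<delta>)" by (simp add: norm_mult)
    also have "cmod (2 * z - \<delta>) \<le> 2 * cmod z + cmod \<delta>"
      using norm_triangle_ineq4[of "2 * z" \<delta>] by (simp add: norm_mult)
    also have "\<dots> \<le> 2 * S + cmod \<delta>" using zS by simp
    finally show ?thesis using k by (simp add: mult_left_mono)
  qed
  have uw2: "cmod (u\<^sup>2 - w\<^sup>2) \<le> a * cmod \<delta> * (2 * S + a * cmod \<delta>)"
  proof -
    have "u\<^sup>2 - w\<^sup>2 = (u - w) * (2 * u - (u - w))" by (simp add: power2_eq_square algebra_simps)
    then have "cmod (u\<^sup>2 - w\<^sup>2) = a * cmod \<delta> * cmod (2 * u - of_real a * \<delta>)"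
      using a by (simp add: norm_mult uw)
    also have "cmod (2 * u - of_real a * \<delta>) \<le> 2 * cmod u + a * cmod \<delta>"
      using norm_triangle_ineq4[of "2 * u" "of_real a * \<delta>"] a by (simp add: norm_mult)
    also have "\<dots> \<le> 2 * S + a * cmod \<delta>" using uS by simp
    finally show ?thesis using a by (simp add: mult_left_mono)
  qed
  \<comment> \<open>The part linear in \<open>\<delta>\<close> gives \<open>600 * S ^ 3\<close>, the
    quadratic part \<open>90000 * S ^ 4\<close>; with \<open>S \<le> 1/4\<close> this is
    \<open>600 + 22500 = 23100\<close>. The bound \<open>k \<ge> 1\<close> yields
    \<open>k + a * a \<le> n * n\<close>, so that only \<open>n * cmod \<delta>\<close>
    enters.\<close>
  have main: "k * cmod (z\<^sup>2 - v\<^sup>2) + cmod (u\<^sup>2 - w\<^sup>2) \<le> 23100 * S ^ 3"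
  proof -
    have "k * cmod (z\<^sup>2 - v\<^sup>2) + cmod (u\<^sup>2 - w\<^sup>2)
        \<le> 2 * (n * cmod \<delta>) * S + (k + a * a) * (cmod \<delta>)\<^sup>2"
      using zv uw2 by (simp add: n_def algebra_simps power2_eq_square)
    also have "\<dots> \<le> 2 * (n * cmod \<delta>) * S + (n * n) * (cmod \<delta>)\<^sup>2"
    proof -
      have "k * 1 \<le> k * k" using k by (intro mult_left_mono) auto
      moreover have "0 \<le> k * a" using k a by simp
      ultimately have "k + a * a \<le> n * n" by (simp add: n_def algebra_simps)
      then show ?thesis by (intro add_left_mono mult_right_mono) auto
    qed
    also have "\<dots> = 2 * (n * cmod \<delta>) * S + (n * cmod \<delta>) ^ 2"
      by (simp add: power2_eq_square)
    also have "\<dots> \<le> 2 * (300 * S\<^sup>2) * S + (300 * S\<^sup>2) ^ 2"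
      using \<delta> S0 n by (intro add_mono mult_right_mono mult_left_mono power_mono) auto
    also have "\<dots> = 600 * S ^ 3 + 90000 * (S ^ 3 * S)"
      by (simp add: eval_nat_numeral)
    also have "\<dots> \<le> 600 * S ^ 3 + 90000 * (S ^ 3 * (1/4))"
      using S4 S0 by (intro add_left_mono mult_left_mono) auto
    finally show ?thesis by simp
  qed
  have energy_v: "energy k a j v = k * (cmod v)\<^sup>2 + (cmod w)\<^sup>2"
    by (simp add: energy_def w_def)
  have Rv: "Re v = 0" by (simp add: v_def base_freq_def)
  have Rw: "Re w = 0" by (simp add: w_def wrapped_def Rv)
  have "2 * n * Re z = Re (2 * of_real n * z)" by simp
  also have "\<dots> = Re (of_real k * z\<^sup>2 + u\<^sup>2) - Re E"
    unfolding twon using Rv by simp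
  also have "Re (of_real k * z\<^sup>2 + u\<^sup>2) = Re D + k * Re (v\<^sup>2) + Re (w\<^sup>2)"
    by (simp add: D_def algebra_simps)
  also have "Re (v\<^sup>2) = - (cmod v)\<^sup>2" by (simp add: cmod_def power2_eq_square Rv)
  also have "Re (w\<^sup>2) = - (cmod w)\<^sup>2" by (simp add: cmod_def power2_eq_square Rw)
  finally have "2 * n * Re z + energy k a j v = Re D - Re E" by (simp add: energy_v)
  moreover have "\<bar>Re D\<bar> \<le> 23100 * S ^ 3"
  proof -
    have "\<bar>Re D\<bar> \<le> cmod D" by (rule abs_Re_le_cmod)
    also have "\<dots> \<le> cmod (of_real k * (z\<^sup>2 - v\<^sup>2)) + cmod (u\<^sup>2 - w\<^sup>2)"
      unfolding D_def by (rule norm_triangle_ineq)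
    also have "\<dots> = k * cmod (z\<^sup>2 - v\<^sup>2) + cmod (u\<^sup>2 - w\<^sup>2)"
      using k by (simp only: norm_mult norm_of_real abs_of_nonneg)
    also note main
    finally show ?thesis .
  qed
  moreover have "\<bar>Re E\<bar> \<le> 600 * S ^ 3" using abs_Re_le_cmod[of E] E by linarith
  moreover have "0 \<le> S ^ 3" using S0 by simp
  ultimately have "\<bar>2 * n * Re z + energy k a j v\<bar> \<le> 100000 * S ^ 3" by linarith
  then show "\<bar>2 * (k + a) * Re z + energy k a j (base_freq (k + a) m)\<bar>
      \<le> 100000 * sqrt (energy k a j z) * energy k a j z"
    by (simp add: n_def[symmetric] v_def[symmetric] S_def[symmetric] S2[symmetric] S0 eval_nat_numeral)
  have "\<bar>S\<^sup>2 - energy k a j v\<bar> \<le> k * \<bar>(cmod z)\<^sup>2 - (cmod v)\<^sup>2\<bar> + \<bar>(cmod u)\<^sup>2 - (cmod w)\<^sup>2\<bar>"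
  proof -
    have "S\<^sup>2 - energy k a j v = k * ((cmod z)\<^sup>2 - (cmod v)\<^sup>2) + ((cmod u)\<^sup>2 - (cmod w)\<^sup>2)"
      unfolding sum2[symmetric] energy_v by (simp add: algebra_simps)
    also have "\<bar>\<dots>\<bar> \<le> \<bar>k * ((cmod z)\<^sup>2 - (cmod v)\<^sup>2)\<bar> + \<bar>(cmod u)\<^sup>2 - (cmod w)\<^sup>2\<bar>"
      by (rule abs_triangle_ineq)
    finally show ?thesis using k by (simp add: abs_mult)
  qed
  also have "\<dots> \<le> k * cmod (z\<^sup>2 - v\<^sup>2) + cmod (u\<^sup>2 - w\<^sup>2)"
    using k norm_triangle_ineq3[of "z\<^sup>2" "v\<^sup>2"] norm_triangle_ineq3[of "u\<^sup>2" "w\<^sup>2"]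
    by (intro add_mono mult_left_mono) (auto simp: norm_power)
  also note main
  also have "23100 * S ^ 3 \<le> 100000 * S ^ 3" using S0 by simp
  finally show "\<bar>energy k a j z - energy k a j (base_freq (k + a) m)\<bar>
      \<le> 100000 * sqrt (energy k a j z) * energy k a j z"
    by (simp add: n_def[symmetric] v_def[symmetric] S_def[symmetric] S2[symmetric] S0 eval_nat_numeral)
qed

text \<open>Turns the cubic errors into relative ones. The threshold \<open>s\<close> is chosen
  before \<open>k\<close>, \<open>a\<close>, \<open>j\<close> and \<open>m\<close>, which is where
  uniformity in \<open>k\<close> comes from.\<close>

lemma resonant_approximation:
  assumes "\<epsilon> > 0"
  obtains s where "s > 0" "s \<le> 1/16"
    "\<And>k a j m z. k \<ge> 1 \<Longrightarrow> a \<ge> 1 \<Longrightarrow> resonant k a j m z \<Longrightarrow> energy k a j z \<le> s \<Longrightarrow>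
      \<bar>2 * (k + a) * Re z + energy k a j (base_freq (k + a) m)\<bar> \<le> \<epsilon> * energy k a j (base_freq (k + a) m)
      \<and> energy k a j z \<le> 2 * energy k a j (base_freq (k + a) m)
      \<and> energy k a j (base_freq (k + a) m) \<le> 2 * energy k a j z"
proof -
  \<comment> \<open>The bound 1/2 makes the energies at \<open>z\<close> and at the base frequency
    comparable within a factor 2; the bound \<open>\<epsilon>/2\<close> pays for that factor in the
    error.\<close>
  define d where "d = min (1/2) (\<epsilon>/2)"
  define t where "t = min (1/4) (d/100000)"
  have d: "0 < d" "d \<le> 1/2" "2 * d \<le> \<epsilon>" using assms by (auto simp: d_def)
  have t: "0 < t" "t \<le> 1/4" "100000 * t \<le> d" using d by (auto simp: t_def)
  have bound: "\<bar>2 * (k + a) * Re z + energy k a j (base_freq (k + a) m)\<bar> \<le> \<epsilon> * energy k a j (base_freq (k + a) m)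
      \<and> energy k a j z \<le> 2 * energy k a j (base_freq (k + a) m)
      \<and> energy k a j (base_freq (k + a) m) \<le> 2 * energy k a j z"
    if k: "k \<ge> 1" and a: "a \<ge> 1" and res: "resonant k a j m z" and W: "energy k a j z \<le> t\<^sup>2" for k a j m z
  proof -
    define Q where "Q = energy k a j (base_freq (k + a) m)"
    define E where "E = energy k a j z"
    have "t\<^sup>2 \<le> (1/4)\<^sup>2" using t by (intro power_mono) auto
    then have E16: "E \<le> 1/16" using W by (simp add: E_def power2_eq_square)
    have E0: "0 \<le> E" using energy_bounds(4)[OF k] by (simp add: E_def)
    have "sqrt E \<le> t" using W t E0 by (intro real_le_lsqrt) (auto simp: E_def)
    then have "100000 * sqrt E * E \<le> d * E"
      using t E0 by (intro mult_right_mono) auto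
    then have 1: "\<bar>2 * (k + a) * Re z + Q\<bar> \<le> d * E" and 2: "\<bar>E - Q\<bar> \<le> d * E"
      using resonant_bounds[OF k a res] E16 unfolding E_def Q_def by auto
    have "d * E \<le> 1/2 * E" using d E0 by (intro mult_right_mono) auto
    then have EQ: "E \<le> 2 * Q" "Q \<le> 2 * E" using 2 by linarith+
    have "d * E \<le> d * (2 * Q)" using d EQ by (intro mult_left_mono) auto
    also have "\<dots> = (2 * d) * Q" by simp
    also have "\<dots> \<le> \<epsilon> * Q" using d EQ E0 by (intro mult_right_mono) auto
    finally show ?thesis using 1 EQ unfolding E_def Q_def by linarith
  qed
  have "t\<^sup>2 \<le> (1/4)\<^sup>2" using t by (intro power_mono) auto
  then have "t\<^sup>2 \<le> 1/16" by (simp add: power2_eq_square)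
  then show ?thesis using that[of "t\<^sup>2"] t bound by simp
qed

lemma sum_power2_le_twice:
  fixes p q :: real
  shows "(p + q)\<^sup>2 \<le> 2 * p\<^sup>2 + 2 * q\<^sup>2"
  using sum_squares_bound[of p q] by (simp add: power2_sum)

text \<open>Resonance is the fixed point equation \<open>T z = z\<close>, where \<open>T\<close>
  corrects the base frequency by the first order remainders. Brouwer's theorem applies since
  \<open>T\<close> is continuous and maps a small disc around the base frequency into
  itself.\<close>

lemma resonant_exists:
  assumes k: "k \<ge> 1" and a: "a \<ge> 1"
    and Q: "energy k a j (base_freq (k + a) m) \<le> 1/10000000"
  obtains z where "resonant k a j m z"
    "energy k a j z \<le> 4 * energy k a j (base_freq (k + a) m)"
proof -
  define n where "n = k + a"
  define v where "v = base_freq n m"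
  define q where "q = energy k a j v"
  define w where "w = wrapped a j v"
  \<comment> \<open>On the disc the energy is at most \<open>4 * q\<close>, so the remainder
    \<open>r\<close> is at most \<open>2400 * q\<close>; dividing by \<open>2 * n\<close> gives this
    radius. The energy bound itself needs \<open>1440000 * q \<le> 1\<close>, hence the smallness
    hypothesis.\<close>
  define \<rho> where "\<rho> = 1200 * q / n"
  define r where "r z = of_real k * (step_log z - 2 * z) + (step_log (wrapped a j z) - 2 * wrapped a j z)" for z
  define T where "T z = v - r z / (2 * of_real n)" for z
  have n: "n > 0" using k a by (simp add: n_def)
  have q: "0 \<le> q" "q \<le> 1/10000000"
    using energy_bounds(4)[OF k] Q by (auto simp: q_def v_def n_def)
  have \<rho>: "0 \<le> \<rho>" "n * \<rho> = 1200 * q" using q n by (auto simp: \<rho>_def)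
  have energy_le: "energy k a j z \<le> 4 * q" if z: "z \<in> cball v \<rho>" for z
  proof -
    have d: "cmod (z - v) \<le> \<rho>" using z by (simp add: dist_norm norm_minus_commute)
    have "cmod z \<le> cmod v + \<rho>" using norm_triangle_ineq[of v "z - v"] d by simp
    then have "(cmod z)\<^sup>2 \<le> (cmod v + \<rho>)\<^sup>2" by (intro power_mono) auto
    also have "\<dots> \<le> 2 * (cmod v)\<^sup>2 + 2 * \<rho>\<^sup>2" by (rule sum_power2_le_twice)
    finally have 1: "k * (cmod z)\<^sup>2 \<le> k * (2 * (cmod v)\<^sup>2 + 2 * \<rho>\<^sup>2)"
      using k by (intro mult_left_mono) auto
    have "wrapped a j z - w = of_real a * (z - v)"
      by (simp add: w_def wrapped_def algebra_simps)
    then have "cmod (wrapped a j z - w) \<le> a * \<rho>"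
      using d a by (simp add: norm_mult mult_left_mono)
    then have "cmod (wrapped a j z) \<le> cmod w + a * \<rho>"
      using norm_triangle_ineq[of w "wrapped a j z - w"] by simp
    then have "(cmod (wrapped a j z))\<^sup>2 \<le> (cmod w + a * \<rho>)\<^sup>2" by (intro power_mono) auto
    also have "\<dots> \<le> 2 * (cmod w)\<^sup>2 + 2 * (a * \<rho>)\<^sup>2" by (rule sum_power2_le_twice)
    finally have "energy k a j z \<le> 2 * q + 2 * ((k + a * a) * \<rho>\<^sup>2)"
      using 1 by (simp add: energy_def q_def w_def algebra_simps power2_eq_square)
    also have "(k + a * a) * \<rho>\<^sup>2 \<le> (n * n) * \<rho>\<^sup>2"
    proof -
      have "k * 1 \<le> k * k" using k by (intro mult_left_mono) auto
      moreover have "0 \<le> k * a" using k a by simp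
      ultimately have "k + a * a \<le> n * n" by (simp add: n_def algebra_simps)
      then show ?thesis by (intro mult_right_mono) auto
    qed
    also have "(n * n) * \<rho>\<^sup>2 = (n * \<rho>)\<^sup>2" by (simp add: power2_eq_square)
    also have "\<dots> = 1440000 * q * q" unfolding \<rho>(2) by (simp add: power2_eq_square)
    also have "\<dots> \<le> 1 * q" using q by (intro mult_right_mono) auto
    finally show ?thesis by simp
  qed
  have small: "cmod z \<le> 1/4 \<and> cmod (wrapped a j z) \<le> 1/4" if z: "z \<in> cball v \<rho>" for z
  proof -
    have "sqrt (energy k a j z) \<le> 1/4"
      using energy_le[OF z] q by (intro real_le_lsqrt) (auto simp: power2_eq_square)
    then show ?thesis using cmod_le_sqrt_energy(1)[OF k, of z a j] cmod_le_sqrt_energy(2)[OF k, of a j z] by linarith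
  qed
  have "continuous_on (cball v \<rho>) (\<lambda>z. step_log z)" "continuous_on (cball v \<rho>) (\<lambda>z. step_log (wrapped a j z))"
    by (rule continuous_on_compose2[OF continuous_on_step_log];
        use small in \<open>auto simp: wrapped_def intro!: continuous_intros\<close>)+
  then have "continuous_on (cball v \<rho>) T"
    unfolding T_def r_def using n by (auto simp: wrapped_def intro!: continuous_intros)
  moreover have "T z \<in> cball v \<rho>" if z: "z \<in> cball v \<rho>" for z
  proof -
    have "cmod (r z) \<le> cmod (of_real k * (step_log z - 2 * z))
        + cmod (step_log (wrapped a j z) - 2 * wrapped a j z)"
      unfolding r_def by (rule norm_triangle_ineq)
    also have "\<dots> \<le> k * (600 * (cmod z)\<^sup>2) + 600 * (cmod (wrapped a j z))\<^sup>2"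
      using step_log_expansion(2)[of z] step_log_expansion(2)[of "wrapped a j z"] small[OF z] k
      by (intro add_mono) (auto simp: norm_mult)
    also have "\<dots> = 600 * energy k a j z" by (simp add: energy_def algebra_simps)
    also have "\<dots> \<le> 2400 * q" using energy_le[OF z] by simp
    finally have "cmod (r z) / (2 * n) \<le> 2400 * q / (2 * n)"
      using n by (intro divide_right_mono) auto
    then show ?thesis using n by (simp add: T_def dist_norm norm_divide norm_mult \<rho>_def)
  qed
  ultimately obtain z where z: "z \<in> cball v \<rho>" "T z = z"
    using brouwer[of "cball v \<rho>" T] \<rho> by auto
  have "resonant k a j m z"
  proof -
    have "r z = 2 * of_real n * (v - z)"
      using z(2) n by (simp add: T_def field_simps)
    moreover have "of_real n * v = (of_real pi * \<i>) * of_int m"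
      using n by (simp add: v_def base_freq_def)
    ultimately have "r z = 2 * ((of_real pi * \<i>) * of_int m) - 2 * of_real n * z"
      by (simp add: algebra_simps)
    then show ?thesis
      by (simp add: r_def resonant_def wrapped_def n_def algebra_simps)
  qed
  then show ?thesis using that energy_le[OF z(1)] by (simp add: q_def v_def n_def)
qed

section \<open>Resonances and roots of the eigenvalue equation\<close>

lemma exp_wrapped: "exp (wrapped (real a) j z) = exp z ^ a"
proof -
  have "exp (wrapped (real a) j z) = exp (of_nat a * z) / exp (\<i> * of_int j * (of_real pi * 2))"
    by (simp add: wrapped_def exp_diff mult_ac)
  also have "exp (\<i> * of_int j * (of_real pi * 2)) = 1"
    using exp_integer_2pi[of "of_int j"] by (simp add: mult_ac)
  finally show ?thesis by (simp add: exp_of_nat_mult)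
qed

lemma exp_step_logs:
  assumes "cmod z \<le> 1/4" "cmod (wrapped (real a) j z) \<le> 1/4"
  shows "exp (of_real (real k) * step_log z + step_log (wrapped (real a) j z)) =
    (2 * exp z - 1) ^ k * (2 * exp z ^ a - 1)"
  using assms by (simp add: exp_add exp_of_nat_mult exp_step_log exp_wrapped)

lemma resonant_imp_root:
  assumes "resonant (real k) (real a) j m z"
    and "cmod z \<le> 1/4" "cmod (wrapped (real a) j z) \<le> 1/4"
  shows "(2 * exp z - 1) ^ k * (2 * exp z ^ a - 1) = 1"
proof -
  have "exp (2 * of_real pi * \<i> * of_int (m - 2 * j)) = 1"
    using exp_integer_2pi[of "of_int (m - 2 * j)"] by (simp add: mult_ac)
  then show ?thesis
    using exp_step_logs[OF assms(2,3), of k] assms(1) by (simp add: resonant_def)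
qed

lemma root_imp_resonant:
  assumes "(2 * exp z - 1) ^ k * (2 * exp z ^ a - 1) = 1"
    and "cmod z \<le> 1/4" "cmod (wrapped (real a) j z) \<le> 1/4"
  obtains m where "resonant (real k) (real a) j m z"
proof -
  define X where "X = of_real (real k) * step_log z + step_log (wrapped (real a) j z)"
  have "exp X = 1" using exp_step_logs[OF assms(2,3), of k] assms(1) by (simp add: X_def)
  then obtain l :: int where l: "Re X = 0" "Im X = of_int (2 * l) * pi"
    by (auto simp: exp_eq_1)
  have "X = 2 * of_real pi * \<i> * of_int l"
    using l by (intro complex_eqI) auto
  then have "resonant (real k) (real a) j (l + 2 * j) z"
    by (simp add: resonant_def X_def)
  then show ?thesis using that by blast
qed

section \<open>Eigenvalues near the unit circle\<close>

text \<open>Half-angle formula together with \<open>sin y \<ge> y / 2\<close> for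
  \<open>y = \<bar>x\<bar> / 2\<close>; the latter follows from the cubic Taylor bound, as
  \<open>pi / 2\<close> is below 1.6.\<close>

lemma power2_le_8_one_minus_cos:
  fixes x :: real
  assumes "\<bar>x\<bar> \<le> pi"
  shows "x\<^sup>2 \<le> 8 * (1 - cos x)"
proof -
  define y where "y = \<bar>x\<bar> / 2"
  have y: "0 \<le> y" "y \<le> 1.6" using assms pi_approx by (auto simp: y_def)
  have "\<bar>sin y - y\<bar> \<le> y ^ 3 / 6"
    using Maclaurin_sin_bound[of y 3] y by (simp add: eval_nat_numeral sin_coeff_def)
  moreover have "y ^ 3 / 6 \<le> y / 2"
  proof -
    have "y\<^sup>2 \<le> 1.6\<^sup>2" using y by (intro power_mono) auto
    then have "y\<^sup>2 \<le> 3" by (simp add: power2_eq_square)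
    then have "y * y\<^sup>2 \<le> y * 3" using y by (intro mult_left_mono) auto
    then show ?thesis by (simp add: eval_nat_numeral)
  qed
  ultimately have "y / 2 \<le> sin y" by linarith
  then have "(y / 2)\<^sup>2 \<le> (sin y)\<^sup>2" using y by (intro power_mono) auto
  moreover have "1 - cos x = 2 * (sin y)\<^sup>2"
  proof -
    have "cos x = cos (2 * y)" by (simp add: y_def)
    then show ?thesis by (simp add: cos_double_sin)
  qed
  ultimately show ?thesis by (simp add: y_def power_divide)
qed

text \<open>The squared modulus equals \<open>1 - 4 * r * (1 - r) + 4 * r * (1 - cos t)\<close> with
  \<open>r = cmod w\<close>: a loss from the radius and a gain from the argument, estimated by
  \<open>r \<le> 1\<close> and \<open>r \<ge> 1/2\<close>.\<close>

lemma cmod_two_minus_1_ge: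
  fixes w :: complex
  assumes "Re w = cmod w * cos t" "1/2 \<le> cmod w" "cmod w \<le> 1"
  shows "1 - 4 * (1 - cmod w) + 2 * (1 - cos t) \<le> (cmod (2 * w - 1))\<^sup>2"
proof -
  define r where "r = cmod w"
  have "(cmod (2 * w - 1))\<^sup>2 = 4 * (cmod w)\<^sup>2 - 4 * Re w + 1"
    unfolding cmod_power2 by (simp add: power2_eq_square algebra_simps)
  also have "\<dots> = 1 - 4 * (r * (1 - r)) + 4 * (r * (1 - cos t))"
    using assms(1) by (simp add: r_def power2_eq_square algebra_simps)
  finally have "(cmod (2 * w - 1))\<^sup>2 = 1 - 4 * (r * (1 - r)) + 4 * (r * (1 - cos t))" .
  moreover have "r * (1 - r) \<le> 1 * (1 - r)"
    using assms by (intro mult_right_mono) (auto simp: r_def)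
  moreover have "1/2 * (1 - cos t) \<le> r * (1 - cos t)"
    using assms by (intro mult_right_mono) (auto simp: r_def)
  ultimately show ?thesis by (simp add: r_def)
qed

text \<open>Outside the closed unit disc \<open>2 * x ^ a - 1\<close> has modulus above 1 and the
  other factor has modulus at least 1.\<close>

lemma root_cmod_le_1:
  fixes x :: complex
  assumes root: "(2 * x - 1) ^ k * (2 * x ^ a - 1) = 1" and "a \<ge> 1"
  shows "cmod x \<le> 1"
proof (rule ccontr)
  assume "\<not> cmod x \<le> 1"
  then have r: "cmod x > 1" by simp
  have 1: "1 < cmod (2 * w - 1)" if "cmod w > 1" for w :: complex
    using that norm_triangle_ineq2[of "2 * w" 1] by (simp add: norm_mult)
  have "1 < cmod (2 * x ^ a - 1)"
    using assms(2) r by (intro 1) (simp add: norm_power one_less_power)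
  moreover have "1 \<le> cmod (2 * x - 1) ^ k"
    using 1[OF r] by (intro one_le_power) auto
  ultimately have "1 * 1 < cmod (2 * x - 1) ^ k * cmod (2 * x ^ a - 1)"
    by (intro mult_le_less_imp_less) auto
  also have "\<dots> = cmod ((2 * x - 1) ^ k * (2 * x ^ a - 1))"
    by (simp add: norm_mult norm_power)
  finally show False unfolding root by simp
qed

text \<open>Near the circle each factor has squared modulus at least 1 plus a gain from its argument
  minus \<open>4 * \<eta>\<close>. The product being 1, neither gain can exceed a multiple of
  \<open>\<eta>\<close>, so both arguments are small.\<close>

lemma root_near_circle_energy:
  fixes x :: complex
  assumes root: "(2 * x - 1) ^ k * (2 * x ^ a - 1) = 1" and k: "k \<ge> 1" and a: "a \<ge> 1"
    and near: "real (k + a) * (1 - cmod x) \<le> \<eta>" and \<eta>: "\<eta> \<le> 1/16"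
  obtains j where "energy (real k) (real a) j (Ln x) \<le> 100 * \<eta>"
proof -
  define r where "r = cmod x"
  define g where "g = 1 - r"
  define z where "z = Ln x"
  define \<theta> where "\<theta> = Im z"
  \<comment> \<open>The nearest integer, so that the argument \<open>\<phi>\<close> of
    \<open>x ^ a\<close> lies in \<open>[-pi, pi]\<close>.\<close>
  define j where "j = round (a * \<theta> / (2 * pi))"
  define \<phi> where "\<phi> = a * \<theta> - 2 * pi * j"
  have r1: "r \<le> 1" unfolding r_def by (rule root_cmod_le_1[OF root a])
  then have g0: "0 \<le> g" by (simp add: g_def)
  have near': "real k * g + real a * g \<le> \<eta>"
    using near by (simp add: g_def r_def algebra_simps)
  have "0 \<le> real k * g" "0 \<le> real a * g" using g0 by auto
  with near' have kg: "real k * g \<le> \<eta>" and ag: "real a * g \<le> \<eta>" by linarith+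
  have "1 * g \<le> real k * g" using k g0 by (intro mult_right_mono) auto
  then have g\<eta>: "g \<le> \<eta>" using kg by linarith
  then have r2: "1/2 \<le> r" using \<eta> by (simp add: g_def)
  then have x0: "x \<noteq> 0" by (auto simp: r_def)
  have \<eta>0: "0 \<le> \<eta>" using g0 g\<eta> by linarith
  have x: "x = exp z" using x0 by (simp add: z_def)
  have Rez: "exp (Re z) = r" by (simp add: r_def x)
  have Rex: "Re x = cmod x * cos \<theta>" by (simp add: x Re_exp \<theta>_def)
  have ra: "cmod (x ^ a) = r ^ a" by (simp add: r_def norm_power)
  have Rexa: "Re (x ^ a) = cmod (x ^ a) * cos \<phi>"
  proof -
    have "x ^ a = exp (of_nat a * z)" by (simp add: x exp_of_nat_mult)
    then have "Re (x ^ a) = cmod (x ^ a) * cos (a * \<theta>)" by (simp add: Re_exp \<theta>_def)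
    moreover have "cos (a * \<theta>) = cos \<phi>"
      using cos_add[of \<phi> "2 * pi * j"] by (simp add: \<phi>_def cos_diff)
    ultimately show ?thesis by simp
  qed
  have ra_ge: "1 - real a * g \<le> r ^ a"
    using Bernoulli_inequality[of "r - 1" a] r2 by (simp add: g_def algebra_simps)
  have ra1: "r ^ a \<le> 1" using r1 r2 by (intro power_le_one) auto
  define X where "X = 2 * (1 - cos \<theta>)"
  define Y where "Y = 2 * (1 - cos \<phi>)"
  define P where "P = ((cmod (2 * x - 1))\<^sup>2) ^ k"
  define R where "R = (cmod (2 * x ^ a - 1))\<^sup>2"
  have X0: "0 \<le> X" and Y0: "0 \<le> Y" by (auto simp: X_def Y_def)
  have kX0: "0 \<le> k * X" using X0 by simp
  \<comment> \<open>Bernoulli's inequality turns the gain \<open>X\<close> of one factor into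
    \<open>k * X\<close> for the power, with no dependence on \<open>k\<close> in the loss.\<close>
  have P: "1 + k * X - 4 * \<eta> \<le> P"
  proof -
    have "1 + (X - 4 * g) \<le> (cmod (2 * x - 1))\<^sup>2"
      using cmod_two_minus_1_ge[OF Rex] r1 r2 by (simp add: X_def g_def r_def)
    moreover have "0 \<le> 1 + (X - 4 * g)" using X0 g\<eta> \<eta> by simp
    ultimately have "(1 + (X - 4 * g)) ^ k \<le> P" unfolding P_def by (intro power_mono)
    moreover have "1 + k * (X - 4 * g) \<le> (1 + (X - 4 * g)) ^ k"
      using X0 g\<eta> \<eta> by (intro Bernoulli_inequality) simp
    ultimately show ?thesis using kg by (simp add: algebra_simps)
  qed
  have R: "1 + Y - 4 * \<eta> \<le> R"
    using cmod_two_minus_1_ge[OF Rexa] ra ra1 ra_ge ag \<eta> by (simp add: R_def Y_def)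
  have PR: "P * R = 1"
  proof -
    have "P * R = (cmod ((2 * x - 1) ^ k * (2 * x ^ a - 1)))\<^sup>2"
      by (simp add: P_def R_def norm_mult norm_power power_mult_distrib flip: power_mult)
         (simp add: mult.commute)
    then show ?thesis by (simp add: root)
  qed
  \<comment> \<open>Since \<open>(1 + 8 * \<eta>) * (1 - 4 * \<eta>) \<ge> 1\<close>, a lower bound
    for one factor bounds the other above. The gains are then at most
    \<open>(8 + 4) * \<eta>\<close>.\<close>
  have other: "A \<le> 1 + 8 * \<eta>" if "A * B = 1" "1 - 4 * \<eta> \<le> B" for A B :: real
  proof (rule ccontr)
    assume "\<not> A \<le> 1 + 8 * \<eta>"
    then have A: "1 + 8 * \<eta> < A" by simp
    have "1 \<le> (1 + 8 * \<eta>) * (1 - 4 * \<eta>)"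
    proof -
      have "\<eta> * \<eta> \<le> \<eta> * (1/16)" using \<eta> \<eta>0 by (intro mult_left_mono) auto
      then show ?thesis using \<eta>0 by (simp add: algebra_simps)
    qed
    also have "\<dots> < A * (1 - 4 * \<eta>)" using A \<eta> by (intro mult_strict_right_mono) auto
    also have "\<dots> \<le> A * B" using that A \<eta>0 by (intro mult_left_mono) auto
    finally show False using that by simp
  qed
  have kX: "k * X \<le> 12 * \<eta>" using other[OF PR] R P Y0 by linarith
  have Y: "Y \<le> 12 * \<eta>" using other[of R P] PR R P kX0 by (simp add: mult.commute)
  have "\<bar>\<theta>\<bar> \<le> pi" using Im_Ln_le_pi[OF x0] mpi_less_Im_Ln[OF x0] by (simp add: \<theta>_def z_def)
  then have "\<theta>\<^sup>2 \<le> 4 * X" using power2_le_8_one_minus_cos[of \<theta>] by (simp add: X_def)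
  then have "k * \<theta>\<^sup>2 \<le> k * (4 * X)" by (intro mult_left_mono) auto
  then have \<theta>: "k * \<theta>\<^sup>2 \<le> 48 * \<eta>" using kX by simp
  have "\<bar>\<phi>\<bar> \<le> pi"
  proof -
    have "\<bar>a * \<theta> / (2 * pi) - j\<bar> \<le> 1/2"
      using of_int_round_abs_le[of "a * \<theta> / (2 * pi)"] by (simp add: j_def abs_minus_commute)
    then have "2 * pi * \<bar>a * \<theta> / (2 * pi) - j\<bar> \<le> 2 * pi * (1/2)"
      by (intro mult_left_mono) auto
    moreover have "\<phi> = 2 * pi * (a * \<theta> / (2 * pi) - j)" by (simp add: \<phi>_def algebra_simps)
    ultimately show ?thesis by (simp add: abs_mult)
  qed
  then have \<phi>: "\<phi>\<^sup>2 \<le> 48 * \<eta>" using power2_le_8_one_minus_cos[of \<phi>] Y by (simp add: Y_def)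
  have Rez2: "\<bar>Re z\<bar> \<le> 2 * g"
  proof -
    have Re0: "Re z = ln r" using Rez by (metis ln_exp)
    have "ln (1 / r) \<le> 1 / r - 1" using r2 by (intro ln_le_minus_one) auto
    also have "\<dots> = g / r" using r2 by (simp add: g_def field_simps)
    also have "\<dots> \<le> g / (1/2)" using r2 g0 by (intro divide_left_mono) auto
    finally show ?thesis using Re0 r1 r2 by (simp add: ln_div)
  qed
  have sq: "(2 * \<eta>)\<^sup>2 \<le> \<eta>"
  proof -
    have "\<eta> * \<eta> \<le> \<eta> * (1/16)" using \<eta> \<eta>0 by (intro mult_left_mono) auto
    then show ?thesis using \<eta>0 by (simp add: power2_eq_square)
  qed
  \<comment> \<open>Enlarging \<open>k\<close> to \<open>k * k\<close> makes the term a square of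
    \<open>k * g\<close>, which is bounded by \<open>\<eta>\<close>.\<close>
  have "k * (Re z)\<^sup>2 \<le> (k * k) * (Re z)\<^sup>2" using k by (intro mult_right_mono) auto
  also have "\<dots> = (k * \<bar>Re z\<bar>)\<^sup>2" by (simp add: power2_eq_square)
  also have "\<dots> \<le> (k * (2 * g))\<^sup>2" using Rez2 by (intro power_mono mult_left_mono) auto
  also have "\<dots> \<le> (2 * \<eta>)\<^sup>2" using kg g0 by (intro power_mono) auto
  finally have 1: "k * (Re z)\<^sup>2 \<le> \<eta>" using sq by simp
  have "(a * Re z)\<^sup>2 = (a * \<bar>Re z\<bar>)\<^sup>2" by (simp add: power2_eq_square)
  also have "\<dots> \<le> (a * (2 * g))\<^sup>2" using Rez2 by (intro power_mono mult_left_mono) auto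
  also have "\<dots> \<le> (2 * \<eta>)\<^sup>2" using ag g0 by (intro power_mono) auto
  finally have 2: "(a * Re z)\<^sup>2 \<le> \<eta>" using sq by simp
  have "energy (real k) (real a) j z = k * (Re z)\<^sup>2 + k * \<theta>\<^sup>2 + (a * Re z)\<^sup>2 + \<phi>\<^sup>2"
    unfolding energy_def cmod_power2 by (simp add: wrapped_def \<theta>_def \<phi>_def algebra_simps)
  \<comment> \<open>The four terms contribute \<open>1 + 48 + 1 + 48 = 98\<close>.\<close>
  also have "\<dots> \<le> 100 * \<eta>" using 1 2 \<theta> \<phi> \<eta>0 by linarith
  finally show ?thesis using that by (simp add: z_def)
qed

section \<open>The spectral gap\<close>

lemma cmod_base_freq: "(cmod (base_freq n m))\<^sup>2 = (pi * m / n)\<^sup>2"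
  by (simp add: base_freq_def cmod_power2)

lemma cmod_wrapped_base_freq:
  "(cmod (wrapped a j (base_freq n m)))\<^sup>2 = (2 * pi * (m * a / (2 * n) - of_int j))\<^sup>2"
proof -
  have "wrapped a j (base_freq n m) = \<i> * of_real (2 * pi * (m * a / (2 * n) - of_int j))"
    by (intro complex_eqI) (auto simp: wrapped_def base_freq_def algebra_simps)
  then show ?thesis by (simp only: norm_mult norm_ii norm_of_real mult_1 power2_abs)
qed

lemma energy_base_freq:
  "energy k a j (base_freq n m) = k * (pi * m / n)\<^sup>2 + (2 * pi * (m * a / (2 * n) - of_int j))\<^sup>2"
  by (simp only: energy_def cmod_base_freq cmod_wrapped_base_freq)

text \<open>Scaled by \<open>2 * n\<close>, \<open>oc_gamma_m\<close> is the energy of the base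
  frequency \<open>m\<close> with the best choice of \<open>j\<close>.\<close>

lemma oc_gamma_m_eq:
  assumes "k < n"
  shows "2 * real n * oc_gamma_m n k m = k * (pi * m / n)\<^sup>2 + (2 * pi * dist_int (m * real (n - k) / (2 * real n)))\<^sup>2"
proof -
  have "real n > 0" using assms by simp
  then show ?thesis using assms
    unfolding oc_gamma_m_def of_nat_diff[OF less_imp_le[OF assms]]
    by (simp add: field_simps power2_eq_square)
qed

lemma dist_int_le: "dist_int x \<le> \<bar>x - of_int j\<bar>"
  unfolding dist_int_def using infdist_le[of "of_int j" \<int> x] by (simp add: dist_real_def)

lemma dist_int_nonneg: "0 \<le> dist_int x"
  by (simp add: dist_int_def infdist_nonneg)

lemma dist_int_attained:
  obtains j where "dist_int x = \<bar>x - of_int j\<bar>"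
proof -
  obtain y :: real where "y \<in> \<int>" "infdist x \<int> = dist x y"
    by (rule infdist_attains_inf[of \<int> x]) auto
  then show ?thesis using that by (auto elim!: Ints_cases simp: dist_int_def dist_real_def)
qed

text \<open>Needed for every \<open>j\<close>, because the \<open>j\<close> attached to a given
  eigenvalue is not known to be optimal for the base frequency.\<close>

lemma oc_gamma_m_le_energy:
  assumes "k < n"
  shows "2 * real n * oc_gamma_m n k m \<le> energy (real k) (real (n - k)) j (base_freq n m)"
proof -
  have "(dist_int (m * real (n - k) / (2 * real n)))\<^sup>2 \<le> \<bar>m * real (n - k) / (2 * real n) - of_int j\<bar>\<^sup>2"
    by (intro power_mono dist_int_le dist_int_nonneg)
  then show ?thesis
    unfolding oc_gamma_m_eq[OF assms] energy_base_freq by (simp add: power_mult_distrib)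
qed

lemma oc_gamma_m_eq_energy:
  assumes "k < n"
  obtains j where "2 * real n * oc_gamma_m n k m = energy (real k) (real (n - k)) j (base_freq n m)"
proof -
  obtain j where "dist_int (m * real (n - k) / (2 * real n)) = \<bar>m * real (n - k) / (2 * real n) - of_int j\<bar>"
    by (rule dist_int_attained)
  then show ?thesis using that
    unfolding oc_gamma_m_eq[OF assms] energy_base_freq by (simp add: power_mult_distrib)
qed

lemma oc_gamma_pos:
  assumes "1 \<le> k" "k < n"
  shows "0 < oc_gamma n k"
proof -
  obtain m where m: "m \<noteq> 0" "oc_gamma n k = oc_gamma_m n k m"
    using oc_gamma_attained[OF assms] by auto
  have "0 < k * (pi * m / n)\<^sup>2" using assms m by simp
  also have "\<dots> \<le> 2 * real n * oc_gamma n k" unfolding m oc_gamma_m_eq[OF assms(2)] by simp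
  finally show ?thesis by (simp add: zero_less_mult_iff)
qed

lemma oc_gamma_le:
  assumes "1 \<le> k" "k < n" "m \<noteq> 0"
  shows "oc_gamma n k \<le> oc_gamma_m n k m"
  using oc_gamma_attained[OF assms(1,2)] assms(3) by auto

text \<open>Dirichlet approximation provides a multiplier \<open>m \<le> M\<close> for which the
  distance term is at most \<open>4 * pi\<^sup>2 / M\<^sup>2\<close>; the other term is at most
  \<open>pi\<^sup>2 * M\<^sup>2 / n\<close>. Choosing \<open>M\<close> first and then
  \<open>N\<close>, both independently of \<open>k\<close>, makes each at most
  \<open>t\<close>.\<close>

lemma n_oc_gamma_small:
  assumes "t > 0"
  obtains N where "\<And>n k. n \<ge> N \<Longrightarrow> 1 \<le> k \<Longrightarrow> k < n \<Longrightarrow> n * oc_gamma n k \<le> t"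
proof -
  obtain M :: nat where M: "real M > 4 * pi\<^sup>2 / t + 1" by (meson reals_Archimedean2)
  have "0 < 4 * pi\<^sup>2 / t" using assms by simp
  with M have M0: "real M > 1" by linarith
  obtain N :: nat where N: "real N > pi\<^sup>2 * (real M)\<^sup>2 / t" by (meson reals_Archimedean2)
  have "n * oc_gamma n k \<le> t" if n: "n \<ge> N" and k: "1 \<le> k" "k < n" for n k
  proof -
    define x where "x = real (n - k) / (2 * real n)"
    have n0: "real n > 0" using k by simp
    have "0 < M" using M0 by simp
    then obtain h m where m: "0 < m" "m \<le> int M" "\<bar>of_int m * x - of_int h\<bar> < 1 / M"
      by (rule Dirichlet_approx)
    have d: "dist_int (m * real (n - k) / (2 * real n)) \<le> 1 / M"
      using dist_int_le[of "m * x" h] m(3) by (simp add: x_def)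
    have mM: "real_of_int m \<le> M" using m(2) by linarith
    have "k * (pi * m / n)\<^sup>2 \<le> n * (pi * M / n)\<^sup>2"
      using k m(1) mM by (intro mult_mono power_mono divide_right_mono mult_left_mono) auto
    also have "\<dots> = pi\<^sup>2 * (real M)\<^sup>2 / n" using n0 by (simp add: field_simps power2_eq_square)
    also have "\<dots> \<le> t"
    proof -
      have "pi\<^sup>2 * (real M)\<^sup>2 / t \<le> n" using N n by linarith
      then show ?thesis using n0 assms by (simp add: field_simps)
    qed
    finally have 1: "k * (pi * m / n)\<^sup>2 \<le> t" .
    have "(2 * pi * dist_int (m * real (n - k) / (2 * real n)))\<^sup>2 \<le> (2 * pi * (1 / M))\<^sup>2"
      using d dist_int_nonneg by (intro power_mono mult_left_mono mult_nonneg_nonneg) auto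
    also have "\<dots> = 4 * pi\<^sup>2 / (real M)\<^sup>2" by (simp add: field_simps power2_eq_square)
    also have "\<dots> \<le> t"
    proof -
      have "4 * pi\<^sup>2 / t \<le> real M" using M by linarith
      also have "real M \<le> (real M)\<^sup>2" using M0 by (simp add: power2_eq_square)
      finally show ?thesis using M0 assms by (simp add: field_simps)
    qed
    finally have "2 * real n * oc_gamma_m n k m \<le> t + t"
      using 1 unfolding oc_gamma_m_eq[OF k(2)] by linarith
    moreover have "n * oc_gamma n k \<le> n * oc_gamma_m n k m"
      using m by (intro mult_left_mono oc_gamma_le[OF k]) auto
    ultimately show ?thesis by linarith
  qed
  then show ?thesis using that by blast
qed

section \<open>Comparison of the gap with the minimum\<close>

lemma oc_gap_le:
  assumes k: "1 \<le> k" "k < n"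
    and "x \<noteq> 1" "(2 * x - 1) ^ k * (2 * x ^ (n - k) - 1) = 1"
  shows "oc_gap n k \<le> 1 - cmod x"
proof -
  have "x \<in> set_mset (proots (char_poly (oc_matrix n k)) - {#1#})"
    using assms oc_nontrivial_eigenvalues[OF k] by simp
  then show ?thesis unfolding oc_gap_def by (simp add: Max_ge)
qed

lemma oc_gap_attained:
  assumes k: "1 \<le> k" "k < n"
  obtains x where "x \<noteq> 1" "(2 * x - 1) ^ k * (2 * x ^ (n - k) - 1) = 1" "oc_gap n k = 1 - cmod x"
proof -
  define E where "E = set_mset (proots (char_poly (oc_matrix n k)) - {#1#})"
  have "Max (norm ` E) \<in> norm ` E"
    using oc_nontrivial_eigenvalues_nonempty[OF k] by (intro Max_in) (auto simp: E_def)
  then obtain x where "x \<in> E" "Max (norm ` E) = norm x" by auto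
  then show ?thesis
    using that[of x] oc_nontrivial_eigenvalues[OF k] by (simp add: E_def oc_gap_def)
qed

lemma oc_gap_asymptotic:
  assumes \<epsilon>: "0 < \<epsilon>" "\<epsilon> < 1"
  obtains N where "\<And>n k. n \<ge> N \<Longrightarrow> 1 \<le> k \<Longrightarrow> k < n \<Longrightarrow>
    \<bar>oc_gap n k - oc_gamma n k\<bar> \<le> 2 * \<epsilon> * oc_gamma n k"
proof -
  obtain s where s: "s > 0" "s \<le> 1/16"
    and approx: "\<And>k a j m z. k \<ge> 1 \<Longrightarrow> a \<ge> 1 \<Longrightarrow> resonant k a j m z \<Longrightarrow> energy k a j z \<le> s \<Longrightarrow>
      \<bar>2 * (k + a) * Re z + energy k a j (base_freq (k + a) m)\<bar> \<le> \<epsilon> * energy k a j (base_freq (k + a) m)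
      \<and> energy k a j z \<le> 2 * energy k a j (base_freq (k + a) m)
      \<and> energy k a j (base_freq (k + a) m) \<le> 2 * energy k a j z"
    using resonant_approximation[OF \<epsilon>(1)] by metis
  \<comment> \<open>With \<open>n * \<gamma> \<le> t\<close>, the second bound meets the hypothesis
    of \<open>resonant_exists\<close>, the third puts the energies \<open>8 * t\<close> and
    \<open>100 * (2 * t)\<close> below \<open>s\<close>, and the first gives
    \<open>\<gamma> \<le> \<epsilon>\<close>, which absorbs a square at the end.\<close>
  define t where "t = min \<epsilon> (min (1/100000000) (s/200))"
  have t: "0 < t" "t \<le> \<epsilon>" "t \<le> 1/100000000" "t \<le> s/200" using \<epsilon> s by (auto simp: t_def)
  obtain N where N: "\<And>n k. n \<ge> N \<Longrightarrow> 1 \<le> k \<Longrightarrow> k < n \<Longrightarrow> n * oc_gamma n k \<le> t"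
    using n_oc_gamma_small[OF t(1)] by metis
  have "\<bar>oc_gap n k - oc_gamma n k\<bar> \<le> 2 * \<epsilon> * oc_gamma n k"
    if n: "n \<ge> N" and k: "1 \<le> k" "k < n" for n k
  proof -
    define a where "a = n - k"
    define \<gamma> where "\<gamma> = oc_gamma n k"
    have a: "a \<ge> 1" "real k + real a = real n" using k by (auto simp: a_def)
    have n0: "real n > 0" using k by simp
    have \<gamma>: "0 < \<gamma>" using oc_gamma_pos[OF k] by (simp add: \<gamma>_def)
    have n\<gamma>: "n * \<gamma> \<le> t" using N[OF n k] by (simp add: \<gamma>_def)
    have r1: "real k \<ge> 1" "real a \<ge> 1" using k a by auto
    note approx' = approx[OF r1, unfolded a(2)]
    have small: "cmod z \<le> 1/4" "cmod (wrapped a j z) \<le> 1/4" if "energy k a j z \<le> 1/16" for j z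
    proof -
      have "sqrt (energy k a j z) \<le> 1/4"
        using that by (intro real_le_lsqrt) (auto simp: power2_eq_square)
      then show "cmod z \<le> 1/4" "cmod (wrapped a j z) \<le> 1/4"
        using cmod_le_sqrt_energy(1)[OF r1(1), of z a j] cmod_le_sqrt_energy(2)[OF r1(1), of a j z]
        by linarith+
    qed
    \<comment> \<open>The minimising \<open>m\<close> yields a nontrivial eigenvalue, and every such
      eigenvalue bounds the gap from above.\<close>
    have upper: "oc_gap n k \<le> (1 + \<epsilon>) * \<gamma>"
    proof -
      obtain m where m: "m \<noteq> 0" "\<gamma> = oc_gamma_m n k m"
        using oc_gamma_attained[OF k] by (auto simp: \<gamma>_def)
      obtain j where Q: "2 * real n * \<gamma> = energy k a j (base_freq n m)"
        using oc_gamma_m_eq_energy[OF k(2)] m(2) unfolding a_def by metis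
      have "energy k a j (base_freq n m) \<le> 1/10000000" using n\<gamma> t by (simp add: Q[symmetric])
      then obtain z where z: "resonant k a j m z" "energy k a j z \<le> 4 * energy k a j (base_freq n m)"
        by (rule resonant_exists[OF r1, unfolded a(2)])
      have W: "energy k a j z \<le> s" using z(2) n\<gamma> t s by (simp add: Q[symmetric])
      then have "energy k a j z \<le> 1/16" using s by simp
      note sm = small[OF this]
      have root: "(2 * exp z - 1) ^ k * (2 * exp z ^ a - 1) = 1"
        by (rule resonant_imp_root[OF z(1) sm])
      have app: "\<bar>2 * real n * Re z + 2 * real n * \<gamma>\<bar> \<le> \<epsilon> * (2 * real n * \<gamma>)"
        using approx'[OF z(1) W] unfolding Q by blast
      \<comment> \<open>Otherwise \<open>Re z\<close> would vanish, whereas it equals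
        \<open>-\<gamma>\<close> up to a relative error \<open>\<epsilon> < 1\<close>.\<close>
      have "exp z \<noteq> 1"
      proof
        assume "exp z = 1"
        then have "Re z = 0" by (simp add: exp_eq_1)
        then have "1 * (2 * real n * \<gamma>) \<le> \<epsilon> * (2 * real n * \<gamma>)" using app \<gamma> n0 by simp
        then show False using \<epsilon> \<gamma> n0 by (simp add: mult_le_cancel_right)
      qed
      then have "oc_gap n k \<le> 1 - cmod (exp z)"
        by (rule oc_gap_le[OF k _ root[unfolded a_def]])
      also have "\<dots> \<le> - Re z" unfolding norm_exp_eq_Re using exp_ge_add_one_self[of "Re z"] by linarith
      also have "\<dots> \<le> (1 + \<epsilon>) * \<gamma>"
      proof -
        have "2 * real n * (- Re z) \<le> 2 * real n * ((1 + \<epsilon>) * \<gamma>)" using app by (simp add: algebra_simps abs_le_iff)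
        then show ?thesis using n0 by (simp only: mult_le_cancel_left_pos)
      qed
      finally show ?thesis .
    qed
    \<comment> \<open>By the upper bound, the eigenvalue attaining the gap lies close enough to the
      circle to be a resonance for some \<open>m\<close>.\<close>
    have lower: "(1 - 2 * \<epsilon>) * \<gamma> \<le> oc_gap n k"
    proof -
      obtain x where x: "x \<noteq> 1" "(2 * x - 1) ^ k * (2 * x ^ a - 1) = 1" "oc_gap n k = 1 - cmod x"
        using oc_gap_attained[OF k] unfolding a_def by metis
      define z where "z = Ln x"
      \<comment> \<open>The eigenvalue 0 would make the gap 1, against the upper bound just
        proved.\<close>
      have x0: "x \<noteq> 0"
      proof
        assume "x = 0"
        then have "1 \<le> (1 + \<epsilon>) * \<gamma>" using upper x(3) by simp
        also have "\<dots> \<le> 2 * (n * \<gamma>)"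
        proof -
          have "1 * \<gamma> \<le> n * \<gamma>" using k \<gamma> by (intro mult_right_mono) auto
          moreover have "(1 + \<epsilon>) * \<gamma> \<le> 2 * \<gamma>" using \<epsilon> \<gamma> by (intro mult_right_mono) auto
          ultimately show ?thesis by simp
        qed
        finally show False using n\<gamma> t by simp
      qed
      have ez: "exp z = x" using x0 by (simp add: z_def)
      have "real (k + a) * (1 - cmod x) \<le> n * ((1 + \<epsilon>) * \<gamma>)"
        using upper x(3) n0 a(2) by (simp add: mult_left_mono)
      also have "\<dots> = (1 + \<epsilon>) * (n * \<gamma>)" by simp
      also have "\<dots> \<le> 2 * t" using \<epsilon> n\<gamma> \<gamma> by (intro mult_mono) auto
      finally have "real (k + a) * (1 - cmod x) \<le> 2 * t" .
      moreover have "2 * t \<le> 1/16" using t by simp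
      ultimately obtain j where "energy k a j z \<le> 100 * (2 * t)"
        unfolding z_def by (rule root_near_circle_energy[OF x(2) k(1) a(1)])
      then have W: "energy k a j z \<le> s" using t by simp
      then have "energy k a j z \<le> 1/16" using s by simp
      note sm = small[OF this]
      obtain m where res: "resonant k a j m z"
        using root_imp_resonant[of z k a j] sm x(2) by (auto simp: ez)
      define Q where "Q = energy k a j (base_freq n m)"
      have app: "\<bar>2 * real n * Re z + Q\<bar> \<le> \<epsilon> * Q" "energy k a j z \<le> 2 * Q" "Q \<le> 2 * energy k a j z"
        using approx'[OF res W] unfolding Q_def by blast+
      \<comment> \<open>For \<open>m = 0\<close> the base frequency is 0, and small energy forces
        \<open>j = 0\<close>. Then the energy of \<open>z\<close> vanishes, so \<open>x = 1\<close>,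
        the excluded eigenvalue.\<close>
      have "m \<noteq> 0"
      proof
        assume m: "m = 0"
        have Qj: "Q = (2 * pi * j)\<^sup>2" by (simp add: Q_def energy_base_freq m)
        have "j = 0"
        proof (rule ccontr)
          assume "j \<noteq> 0"
          then have "1 \<le> \<bar>real_of_int j\<bar>" by linarith
          then have "2 * 3 * 1 \<le> 2 * pi * \<bar>real_of_int j\<bar>" using pi_gt3 by (intro mult_mono) auto
          then have "(2 * 3 * 1)\<^sup>2 \<le> (2 * pi * \<bar>real_of_int j\<bar>)\<^sup>2" by (intro power_mono) auto
          then have "36 \<le> Q" by (simp add: Qj power_mult_distrib)
          then show False using app(3) W s by simp
        qed
        then have "energy k a j z \<le> 0" using app(2) Qj by simp
        then have "(cmod z)\<^sup>2 \<le> 0" using energy_bounds(1)[OF r1(1)] order_trans by blast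
        then have "z = 0" by simp
        then show False using x(1) ez by simp
      qed
      then have "\<gamma> \<le> oc_gamma_m n k m" using oc_gamma_le[OF k] by (simp add: \<gamma>_def)
      then have "2 * real n * \<gamma> \<le> 2 * real n * oc_gamma_m n k m" by (intro mult_left_mono) auto
      also have "\<dots> \<le> Q" using oc_gamma_m_le_energy[OF k(2)] by (simp add: Q_def a_def)
      finally have "(1 - \<epsilon>) * (2 * real n * \<gamma>) \<le> (1 - \<epsilon>) * Q" using \<epsilon> by (intro mult_left_mono) auto
      also have "\<dots> \<le> 2 * real n * (- Re z)" using app(1) by (simp add: algebra_simps abs_le_iff)
      finally have "2 * real n * ((1 - \<epsilon>) * \<gamma>) \<le> 2 * real n * (- Re z)" by (simp add: algebra_simps)
      then have y: "(1 - \<epsilon>) * \<gamma> \<le> - Re z" using n0 by (simp only: mult_le_cancel_left_pos)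
      define y where "y = (1 - \<epsilon>) * \<gamma>"
      have y0: "0 \<le> y" using \<epsilon> \<gamma> by (simp add: y_def)
      have "cmod x = exp (Re z)" by (simp flip: ez)
      also have "\<dots> \<le> exp (- y)" using y by (simp add: y_def)
      \<comment> \<open>Passing from \<open>- Re z\<close> to \<open>1 - cmod x\<close> costs at
        most \<open>y\<^sup>2 \<le> \<epsilon> * \<gamma>\<close>, which accounts for the second
        \<open>\<epsilon>\<close> in the bound.\<close>
      also have "\<dots> \<le> inverse (1 + y)"
        using exp_ge_add_one_self[of y] y0 by (simp add: exp_minus le_imp_inverse_le)
      also have "\<dots> \<le> 1 - y + y\<^sup>2"
      proof -
        have "1 \<le> (1 - y + y\<^sup>2) * (1 + y)"
          using y0 by (simp add: algebra_simps power2_eq_square)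
        then show ?thesis using y0 by (simp add: inverse_eq_divide divide_le_eq)
      qed
      finally have "y - y\<^sup>2 \<le> oc_gap n k" using x(3) by simp
      moreover have "y\<^sup>2 \<le> \<epsilon> * \<gamma>"
      proof -
        have "1 * \<gamma> \<le> n * \<gamma>" using k \<gamma> by (intro mult_right_mono) auto
        then have "\<gamma> \<le> \<epsilon>" using n\<gamma> t by simp
        moreover have "y \<le> 1 * \<gamma>" unfolding y_def using \<epsilon> \<gamma> by (intro mult_right_mono) auto
        ultimately have "y * y \<le> \<epsilon> * \<gamma>" using y0 \<epsilon> by (intro mult_mono) auto
        then show ?thesis by (simp add: power2_eq_square)
      qed
      ultimately show ?thesis by (simp add: y_def algebra_simps)
    qed
    have "(1 + \<epsilon>) * \<gamma> \<le> (1 + 2 * \<epsilon>) * \<gamma>" using \<epsilon> \<gamma> by (intro mult_right_mono) auto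
    then show ?thesis using upper lower unfolding \<gamma>_def[symmetric] abs_le_iff
      by (simp add: algebra_simps)
  qed
  then show ?thesis using that by blast
qed

theorem theorem4:
  shows "\<exists>e :: nat \<Rightarrow> nat \<Rightarrow> real.
    (\<forall>n k. 1 \<le> k \<and> k < n \<longrightarrow> oc_gap n k = (1 + e n k) * oc_gamma n k) \<and>
    (\<forall>\<epsilon>>0. \<exists>N. \<forall>n\<ge>N. \<forall>k. 1 \<le> k \<and> k < n \<longrightarrow> \<bar>e n k\<bar> < \<epsilon>)"
proof (intro exI[of _ "\<lambda>n k. oc_gap n k / oc_gamma n k - 1"] conjI allI impI)
  fix n k :: nat
  assume "1 \<le> k \<and> k < n"
  then have "oc_gamma n k > 0" using oc_gamma_pos by simp
  then show "oc_gap n k = (1 + (oc_gap n k / oc_gamma n k - 1)) * oc_gamma n k" by simp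
next
  fix \<epsilon> :: real
  assume "\<epsilon> > 0"
  \<comment> \<open>The bound 1/2 keeps \<open>\<delta>\<close> below 1; dividing by 4 makes
    \<open>2 * \<delta>\<close> strictly smaller than \<open>\<epsilon>\<close>.\<close>
  define \<delta> where "\<delta> = min (1/2) (\<epsilon>/4)"
  have \<delta>: "0 < \<delta>" "\<delta> < 1" "2 * \<delta> < \<epsilon>" using \<open>\<epsilon> > 0\<close> by (auto simp: \<delta>_def)
  obtain N where N: "\<And>n k. n \<ge> N \<Longrightarrow> 1 \<le> k \<Longrightarrow> k < n \<Longrightarrow>
      \<bar>oc_gap n k - oc_gamma n k\<bar> \<le> 2 * \<delta> * oc_gamma n k"
    using oc_gap_asymptotic[OF \<delta>(1,2)] by metis
  have "\<bar>oc_gap n k / oc_gamma n k - 1\<bar> < \<epsilon>" if "n \<ge> N" "1 \<le> k" "k < n" for n k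
  proof -
    have pos: "oc_gamma n k > 0" using oc_gamma_pos that by simp
    have "\<bar>oc_gap n k / oc_gamma n k - 1\<bar> = \<bar>oc_gap n k - oc_gamma n k\<bar> / oc_gamma n k"
    proof -
      have "oc_gap n k / oc_gamma n k - 1 = (oc_gap n k - oc_gamma n k) / oc_gamma n k"
        using pos by (simp add: diff_divide_distrib)
      then show ?thesis using pos by (simp add: abs_divide)
    qed
    also have "\<dots> \<le> 2 * \<delta>" using N[OF that] pos by (simp add: divide_le_eq)
    finally show ?thesis using \<delta> by linarith
  qed
  then show "\<exists>N. \<forall>n\<ge>N. \<forall>k. 1 \<le> k \<and> k < n \<longrightarrow> \<bar>oc_gap n k / oc_gamma n k - 1\<bar> < \<epsilon>"
    by blast
qed

end
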